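(* Assume that $\widehat\Sigma\succ0$, $\rho>0$ and $\sigma\in(0,\frac12)$. Let $\mathcal E\subseteq\{1,\dots,p\}^2$ be symmetric (i.e. $(i,j)\in\mathcal E\Rightarrow(j,i)\in\mathcal E$) and let $\mathcal X=\{X\in\mathbb S_{++}^p:X_{ij}=0\ \forall(i,j)\in\mathcal E\}$. For any initial feasible solution $(X_0,\gamma_0)$ of the problem $$\inf_{X,\gamma}\big\{f(X,\gamma):\gamma I\succ X\succ0,\;X\in\mathcal X\big\},\qquad f(X,\gamma)=-\log\det X+\gamma\big(\rho^2-\mathrm{Tr}[\widehat\Sigma]\big)+\gamma^2\big\langle(\gamma I-X)^{-1},\widehat\Sigma\big\rangle,$$ the sequence $\{(X_t,\gamma_t)\}_{t\in\mathbb Z_+}$ generated by the sequential quadratic approximation algorithm (described in the context) converges to the unique minimizer $(X^\star,\gamma^\star)$ of this problem. Moreover, the sequence converges locally quadratically.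
   Context: $\mathbb S^p$, $\mathbb S_+^p$, $\mathbb S_{++}^p$ denote the symmetric, symmetric positive semidefinite and symmetric positive definite real $p\times p$ matrices; $A\succ B$ means $A-B\in\mathbb S_{++}^p$; $\langle A,B\rangle=\mathrm{Tr}[A^\top B]$; $\otimes$ is the Kronecker product; $\mathrm{vec}$ stacks the columns of a matrix, so that entry $(i,j)$ has index $(j-1)p+i$. Descent direction at a feasible $(X,\gamma)$. Set $G=I-X/\gamma$, $$H=\begin{bmatrix}X^{-1}\otimes X^{-1}+\frac2\gamma G^{-1}\widehat\Sigma G^{-1}\otimes G^{-1}&h\\ h^\top&\frac2{\gamma^3}\mathrm{Tr}[G^{-1}XG^{-1}\widehat\Sigma G^{-1}X]\end{bmatrix}\in\mathbb S^{p^2+1},$$ $$h=-\tfrac1{\gamma^2}\mathrm{vec}\big(G^{-1}[XG^{-1}\widehat\Sigma+\widehat\Sigma G^{-1}X]G^{-1}\big),\qquad g=\begin{bmatrix}\mathrm{vec}(G^{-1}\widehat\Sigma G^{-1}-X^{-1})\\ \rho^2+\mathrm{Tr}[G^{-1}\widehat\Sigma(I-\frac1\gamma G^{-1}X)-\widehat\Sigma]\end{bmatrix}\in\mathbb R^{p^2+1}.$$ Let $P:\mathbb R^{p^2+1}\to\mathbb R^{p^2+1}$ be the orthogonal projection given by $(Pz)_k=0$ if $k=(j-1)p+i$ with $(i,j)\in\mathcal E$; $(Pz)_k=\frac12z_{(j-1)p+i}+\frac12z_{(i-1)p+j}$ if $k=(j-1)p+i$ with $i,j\le p$, $(i,j)\notin\mathcal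 E$; and $(Pz)_{p^2+1}=z_{p^2+1}$. The direction $(\Delta_X^\star,\Delta_\gamma^\star)\in\mathbb S^p\times\mathbb R$ is the unique solution of $$P\big(H(\mathrm{vec}(\Delta_X^\star)^\top,\Delta_\gamma^\star)^\top+g\big)=0,\qquad(\Delta_X^\star)_{ij}=0\ \ \forall(i,j)\in\mathcal E.$$ Algorithm. Starting from $(X_0,\gamma_0)$, in iteration $t=0,1,2,\dots$ compute the direction $(\Delta_X^\star,\Delta_\gamma^\star)$ at $(X,\gamma)=(X_t,\gamma_t)$; let $\alpha_t$ be the largest number $\alpha\in\{2^{-m}:m\in\mathbb Z_+\}$ satisfying (C1) $(\gamma+\alpha\Delta_\gamma^\star)I\succ X+\alpha\Delta_X^\star\succ0$ and (C2) $f(X+\alpha\Delta_X^\star,\gamma+\alpha\Delta_\gamma^\star)\le f(X,\gamma)+\sigma\alpha\delta$ with $\delta=g^\top(\mathrm{vec}(\Delta_X^\star)^\top,\Delta_\gamma^\star)^\top$; and set $X_{t+1}=X_t+\alpha_t\Delta_X^\star$, $\gamma_{t+1}=\gamma_t+\alpha_t\Delta_\gamma^\star$. (The iteration is continued indefinitely, without a stopping criterion.) Local quadratic convergence means that there are a constant $C$ and an index $T$ such that the distance of the $(t+1)$-st iterate to $(X^\star,\gamma^\star)$ is at most $C$ times the square of the distance of the $t$-th iterate to $(X^\star,\gamma^\star)$ for all $t\ge T$. *)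

theory Defs
  imports "HOL-Analysis.Analysis"
begin

text \<open>
  The dimension \<open>p\<close> is the cardinality of the index type \<^typ>\<open>'p::finite\<close>.
  The index set of vectors of length \<open>p\<^sup>2\<close> is \<^typ>\<open>'p \<times> 'p\<close>, where the pair \<open>(j, i)\<close>
  plays the role of the number \<open>(j - 1) p + i\<close>; the index set of size \<open>p\<^sup>2 + 1\<close> is
  \<^typ>\<open>'p \<times> 'p + unit\<close>, where \<open>Inr ()\<close> is the last index.
\<close>

definition sym_mat :: "real^'p^'p \<Rightarrow> bool" where
  "sym_mat A \<longleftrightarrow> transpose A = A"

definition pos_def :: "real^'p^'p \<Rightarrow> bool" where
  "pos_def A \<longleftrightarrow> sym_mat A \<and> (\<forall>x. x \<noteq> 0 \<longrightarrow> 0 < x \<bullet> (A *v x))"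

definition loewner_greater :: "real^'p^'p \<Rightarrow> real^'p^'p \<Rightarrow> bool" (infix "\<succ>" 50) where
  "A \<succ> B \<longleftrightarrow> pos_def (A - B)"

definition frob :: "real^'p^'p \<Rightarrow> real^'p^'p \<Rightarrow> real" where
  "frob A B = trace (transpose A ** B)"

definition kron :: "real^'n^'m \<Rightarrow> real^'l^'k \<Rightarrow> real^('n \<times> 'l)^('m \<times> 'k)"
    (infixl "\<otimes>\<^sub>K" 72) where
  "A \<otimes>\<^sub>K B = (\<chi> r c. A $ fst r $ fst c * B $ snd r $ snd c)"

text \<open>Column stacking: the first component of an index is the column, the second the row.\<close>

definition vec_cols :: "real^'p^'p \<Rightarrow> real^('p \<times> 'p)" where
  "vec_cols A = (\<chi> k. A $ snd k $ fst k)"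

definition append_entry :: "real^'n \<Rightarrow> real \<Rightarrow> real^('n + unit)" where
  "append_entry v c = (\<chi> k. case k of Inl a \<Rightarrow> v $ a | Inr _ \<Rightarrow> c)"

text \<open>The block matrix with blocks \<open>A\<close>, \<open>b\<close> in the upper and \<open>b\<^sup>T\<close>, \<open>c\<close> in the lower row.\<close>

definition bordered :: "real^'n^'n \<Rightarrow> real^'n \<Rightarrow> real \<Rightarrow> real^('n + unit)^('n + unit)" where
  "bordered A b c = (\<chi> k l. case k of
      Inl a \<Rightarrow> (case l of Inl a' \<Rightarrow> A $ a $ a' | Inr _ \<Rightarrow> b $ a)
    | Inr _ \<Rightarrow> (case l of Inl a' \<Rightarrow> b $ a' | Inr _ \<Rightarrow> c))"

definition sparsity_cone :: "('p \<times> 'p) set \<Rightarrow> (real^'p^'p) set" where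
  "sparsity_cone E = {X. pos_def X \<and> (\<forall>(i, j)\<in>E. X $ i $ j = 0)}"

text \<open>Below, \<open>S\<close> stands for the nominal covariance matrix written with a hat in the literature,
  and \<open>mat \<gamma>\<close> is \<open>\<gamma>\<close> times the identity matrix.\<close>

definition feasible :: "('p::finite \<times> 'p) set \<Rightarrow> (real^'p^'p) \<times> real \<Rightarrow> bool" where
  "feasible E = (\<lambda>(X, \<gamma>). mat \<gamma> \<succ> X \<and> X \<succ> 0 \<and> X \<in> sparsity_cone E)"

definition objective ::
    "real^'p^'p \<Rightarrow> real \<Rightarrow> (real^'p^'p) \<times> real \<Rightarrow> real" where
  "objective S \<rho> = (\<lambda>(X, \<gamma>). - ln (det X) + \<gamma> * (\<rho>\<^sup>2 - trace S)
     + \<gamma>\<^sup>2 * frob (matrix_inv (mat \<gamma> - X)) S)"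

definition G_mat :: "real^'p^'p \<Rightarrow> real \<Rightarrow> real^'p^'p" where
  "G_mat X \<gamma> = mat 1 - (1 / \<gamma>) *\<^sub>R X"

definition hess :: "real^'p^'p \<Rightarrow> real^'p^'p \<Rightarrow> real \<Rightarrow>
    real^('p \<times> 'p + unit)^('p \<times> 'p + unit)" where
  "hess S X \<gamma> = (let Gi = matrix_inv (G_mat X \<gamma>); Xi = matrix_inv X in
     bordered
       (Xi \<otimes>\<^sub>K Xi + ((2 / \<gamma>) *\<^sub>R (Gi ** S ** Gi)) \<otimes>\<^sub>K Gi)
       (- (1 / \<gamma>\<^sup>2) *\<^sub>R vec_cols (Gi ** (X ** Gi ** S + S ** Gi ** X) ** Gi))
       (2 / \<gamma> ^ 3 * trace (Gi ** X ** Gi ** S ** Gi ** X)))"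

definition grad :: "real^'p^'p \<Rightarrow> real \<Rightarrow> real^'p^'p \<Rightarrow> real \<Rightarrow> real^('p \<times> 'p + unit)" where
  "grad S \<rho> X \<gamma> = (let Gi = matrix_inv (G_mat X \<gamma>); Xi = matrix_inv X in
     append_entry
       (vec_cols (Gi ** S ** Gi - Xi))
       (\<rho>\<^sup>2 + trace (Gi ** S ** (mat 1 - (1 / \<gamma>) *\<^sub>R (Gi ** X)) - S)))"

definition sparsity_proj :: "('p::finite \<times> 'p) set \<Rightarrow> real^('p \<times> 'p + unit) \<Rightarrow> real^('p \<times> 'p + unit)" where
  "sparsity_proj E z = (\<chi> k. case k of
      Inl (j, i) \<Rightarrow> (if (i, j) \<in> E then 0
        else 1 / 2 * z $ Inl (j, i) + 1 / 2 * z $ Inl (i, j))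
    | Inr _ \<Rightarrow> z $ Inr ())"

definition is_direction :: "real^'p^'p \<Rightarrow> real \<Rightarrow> ('p \<times> 'p) set \<Rightarrow>
    (real^'p^'p) \<times> real \<Rightarrow> (real^'p^'p) \<times> real \<Rightarrow> bool" where
  "is_direction S \<rho> E = (\<lambda>(X, \<gamma>) (DX, D\<gamma>). sym_mat DX
     \<and> sparsity_proj E (hess S X \<gamma> *v append_entry (vec_cols DX) D\<gamma> + grad S \<rho> X \<gamma>) = 0
     \<and> (\<forall>(i, j)\<in>E. DX $ i $ j = 0))"

definition direction :: "real^'p^'p \<Rightarrow> real \<Rightarrow> ('p \<times> 'p) set \<Rightarrow>
    (real^'p^'p) \<times> real \<Rightarrow> (real^'p^'p) \<times> real" where
  "direction S \<rho> E z = (THE d. is_direction S \<rho> E z d)"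

definition slope :: "real^'p^'p \<Rightarrow> real \<Rightarrow> (real^'p^'p) \<times> real \<Rightarrow> (real^'p^'p) \<times> real \<Rightarrow> real" where
  "slope S \<rho> = (\<lambda>(X, \<gamma>) (DX, D\<gamma>). grad S \<rho> X \<gamma> \<bullet> append_entry (vec_cols DX) D\<gamma>)"

definition cond1 :: "(real^'p^'p) \<times> real \<Rightarrow> (real^'p^'p) \<times> real \<Rightarrow> real \<Rightarrow> bool" where
  "cond1 = (\<lambda>(X, \<gamma>) (DX, D\<gamma>) \<alpha>.
     mat (\<gamma> + \<alpha> * D\<gamma>) \<succ> X + \<alpha> *\<^sub>R DX \<and> X + \<alpha> *\<^sub>R DX \<succ> 0)"

definition cond2 :: "real^'p^'p \<Rightarrow> real \<Rightarrow> real \<Rightarrow>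
    (real^'p^'p) \<times> real \<Rightarrow> (real^'p^'p) \<times> real \<Rightarrow> real \<Rightarrow> bool" where
  "cond2 S \<rho> \<sigma> z d \<alpha> \<longleftrightarrow>
     objective S \<rho> (z + \<alpha> *\<^sub>R d) \<le> objective S \<rho> z + \<sigma> * \<alpha> * slope S \<rho> z d"

definition step_size :: "real^'p^'p \<Rightarrow> real \<Rightarrow> real \<Rightarrow>
    (real^'p^'p) \<times> real \<Rightarrow> (real^'p^'p) \<times> real \<Rightarrow> real" where
  "step_size S \<rho> \<sigma> z d =
     (GREATEST \<alpha>. (\<exists>m::nat. \<alpha> = 1 / 2 ^ m) \<and> cond1 z d \<alpha> \<and> cond2 S \<rho> \<sigma> z d \<alpha>)"

definition sqa_step :: "real^'p^'p \<Rightarrow> real \<Rightarrow> real \<Rightarrow> ('p \<times> 'p) set \<Rightarrow>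
    (real^'p^'p) \<times> real \<Rightarrow> (real^'p^'p) \<times> real" where
  "sqa_step S \<rho> \<sigma> E z = (let d = direction S \<rho> E z in z + step_size S \<rho> \<sigma> z d *\<^sub>R d)"

primrec sqa_iter :: "real^'p^'p \<Rightarrow> real \<Rightarrow> real \<Rightarrow> ('p \<times> 'p) set \<Rightarrow>
    (real^'p^'p) \<times> real \<Rightarrow> nat \<Rightarrow> (real^'p^'p) \<times> real" where
  "sqa_iter S \<rho> \<sigma> E z0 0 = z0"
| "sqa_iter S \<rho> \<sigma> E z0 (Suc t) = sqa_step S \<rho> \<sigma> E (sqa_iter S \<rho> \<sigma> E z0 t)"

definition locally_quadratic_convergence ::
    "(nat \<Rightarrow> 'a::metric_space) \<Rightarrow> 'a \<Rightarrow> bool" where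
  "locally_quadratic_convergence z zs \<longleftrightarrow>
     (\<exists>C T. \<forall>t\<ge>T. dist (z (Suc t)) zs \<le> C * (dist (z t) zs)\<^sup>2)"

end

theory Submission
  imports Defs
begin

text \<open>
  The algorithm is Newton's method with Armijo backtracking for a strictly convex function
  \<open>f\<close> on a convex set that is relatively open in the subspace \<open>V\<close> of pairs \<open>(D, \<delta>)\<close> with \<open>D\<close>
  symmetric and vanishing on \<open>E\<close>. Its convergence from every feasible point rests on three
  properties of \<open>f\<close>: sublevel sets are compact, the second derivative is positive definite
  on \<open>V\<close>, and on compact sets the gradient has first-order expansions with a uniformly
  quadratic remainder.

  These properties suffice, as the locale \<open>damped_newton\<close> shows. The iterates stay in the
  compact sublevel set of the initial point; around its convex hull there is a compact
  convex set on which \<open>m |d|\<^sup>2 \<le> H d \<bullet> d\<close>, \<open>|H d| \<le> L |d|\<close> and all remainders have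
  one constant. Hence step sizes are at least some \<open>\<beta> > 0\<close>, each step lowers \<open>f\<close> by at least
  \<open>\<sigma> \<beta> m |d|\<^sup>2\<close>, and the directions tend to \<open>0\<close>. Strong monotonicity of the gradient bounds
  the distance to the minimizer by \<open>(L / m) |d|\<close>, which gives convergence. Once \<open>d\<close> is small, the
  cubic remainder of \<open>f\<close> is absorbed by the gap between \<open>\<sigma>\<close> and \<open>1/2\<close>, so full Newton
  steps are taken, and these contract the error quadratically.

  For the objective at hand put \<open>M = (\<gamma> I - X)\<^sup>-\<^sup>1\<close>, so that \<open>G\<^sup>-\<^sup>1 = \<gamma> M\<close>, and \<open>W = \<delta> I - D\<close>.
  All derivatives are then noncommutative polynomials in \<open>M\<close>, \<open>S\<close>, \<open>W\<close>, \<open>X\<^sup>-\<^sup>1\<close>, \<open>D\<close>, and the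
  expansion property reduces to that of the matrix inverse. The second derivative is
  \<open>tr (X\<^sup>-\<^sup>1 D X\<^sup>-\<^sup>1 D) + 2 tr (S Q\<^sup>T M Q)\<close> with \<open>Q = \<delta> I - \<gamma> W M\<close>, which is positive
  because \<open>tr (A Q\<^sup>T B Q) > 0\<close> for positive definite \<open>A\<close>, \<open>B\<close> and \<open>Q \<noteq> 0\<close>
  (\<open>trace_congruence_pos\<close>). Compactness comes from the identity
  \<open>f = - log det X + tr (S X) + \<gamma> \<rho>\<^sup>2 + tr (S X M X)\<close> together with the tangent inequality of
  \<open>log det\<close> at \<open>S\<^sup>-\<^sup>1\<close> (\<open>compact_sublevel\<close>). Finally, the matrix \<open>hess\<close> represents the second
  derivative on symmetric matrices only, but the projection in the
  definition of the direction tests against nothing else (\<open>is_direction_iff\<close>).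
\<close>

section \<open>First-order expansions with a uniformly quadratic remainder\<close>

text \<open>
  The bounds on the function and on the derivative make the notion closed under
  bilinear products on any set \<open>C\<close>.
\<close>

definition quad_approx :: "'a::real_normed_vector set \<Rightarrow> ('a \<Rightarrow> 'b::real_normed_vector) \<Rightarrow> ('a \<Rightarrow> 'a \<Rightarrow> 'b) \<Rightarrow> bool" where
  "quad_approx C F F' \<longleftrightarrow> (\<exists>L\<ge>0. \<forall>x\<in>C. norm (F x) \<le> L \<and> (\<forall>d. norm (F' x d) \<le> L * norm d)
     \<and> (\<forall>y\<in>C. norm (F y - F x - F' x (y - x)) \<le> L * (norm (y - x))\<^sup>2))"

lemma quad_approxI:
  assumes "L \<ge> 0" "\<And>x. x \<in> C \<Longrightarrow> norm (F x) \<le> L" "\<And>x d. x \<in> C \<Longrightarrow> norm (F' x d) \<le> L * norm d"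
    "\<And>x y. x \<in> C \<Longrightarrow> y \<in> C \<Longrightarrow> norm (F y - F x - F' x (y - x)) \<le> L * (norm (y - x))\<^sup>2"
  shows "quad_approx C F F'"
  unfolding quad_approx_def using assms by blast

lemma quad_approxE:
  assumes "quad_approx C F F'"
  obtains L where "L \<ge> 0" "\<And>x. x \<in> C \<Longrightarrow> norm (F x) \<le> L" "\<And>x d. x \<in> C \<Longrightarrow> norm (F' x d) \<le> L * norm d"
    "\<And>x y. x \<in> C \<Longrightarrow> y \<in> C \<Longrightarrow> norm (F y - F x - F' x (y - x)) \<le> L * (norm (y - x))\<^sup>2"
  using assms unfolding quad_approx_def by blast

lemma quad_approx_cong:
  assumes "quad_approx C F F'" "\<And>x. x \<in> C \<Longrightarrow> F x = G x" "\<And>x d. x \<in> C \<Longrightarrow> F' x d = G' x d"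
  shows "quad_approx C G G'"
  using assms unfolding quad_approx_def by simp

lemma quad_approx_const: "quad_approx C (\<lambda>_. c) (\<lambda>_ _. 0)"
  by (rule quad_approxI[of "norm c"]) auto

lemma quad_approx_bounded_linear:
  assumes h: "bounded_linear h" and C: "bounded C"
  shows "quad_approx C h (\<lambda>_. h)"
proof -
  obtain K where K: "K \<ge> 0" "\<And>x. norm (h x) \<le> norm x * K"
    using bounded_linear.nonneg_bounded[OF h] by blast
  obtain R where R: "R > 0" "\<And>x. x \<in> C \<Longrightarrow> norm x \<le> R" using C bounded_pos by blast
  have 1: "norm (h x) \<le> K * (R + 1)" if "x \<in> C" for x
  proof -
    have "norm (h x) \<le> norm x * K" by (rule K)
    also have "\<dots> \<le> (R + 1) * K" using R(2)[OF that] K(1) by (intro mult_right_mono) auto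
    finally show ?thesis by (simp add: mult.commute)
  qed
  have 2: "norm (h d) \<le> K * (R + 1) * norm d" for d
  proof -
    have "norm (h d) \<le> norm d * K" by (rule K)
    also have "\<dots> \<le> norm d * (K * (R + 1))" using R(1) K(1) by (intro mult_left_mono) (auto simp: algebra_simps)
    finally show ?thesis by (simp add: mult.commute)
  qed
  show ?thesis
    by (rule quad_approxI[of "K * (R + 1)"])
      (use K R(1) 1 2 bounded_linear.linear[OF h] in \<open>auto simp: linear_diff\<close>)
qed

lemma quad_approx_compose:
  assumes h: "bounded_linear h" and F: "quad_approx C F F'"
  shows "quad_approx C (\<lambda>x. h (F x)) (\<lambda>x d. h (F' x d))"
proof -
  obtain K where K: "K \<ge> 0" "\<And>x. norm (h x) \<le> norm x * K"
    using bounded_linear.nonneg_bounded[OF h] by blast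
  obtain L where L: "L \<ge> 0" "\<And>x. x \<in> C \<Longrightarrow> norm (F x) \<le> L"
    "\<And>x d. x \<in> C \<Longrightarrow> norm (F' x d) \<le> L * norm d"
    "\<And>x y. x \<in> C \<Longrightarrow> y \<in> C \<Longrightarrow> norm (F y - F x - F' x (y - x)) \<le> L * (norm (y - x))\<^sup>2"
    using quad_approxE[OF F] by metis
  have *: "norm (h a) \<le> L * K * r" if "norm a \<le> L * r" for a r
    using K(2)[of a] mult_right_mono[OF that K(1)] by (simp add: mult_ac)
  show ?thesis
    by (rule quad_approxI[of "L * K"])
      (use K(1) L *[of _ 1] * in \<open>auto simp flip: linear_diff[OF bounded_linear.linear[OF h]]\<close>)
qed

lemma quad_approx_add:
  assumes F: "quad_approx C F F'" and G: "quad_approx C G G'"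
  shows "quad_approx C (\<lambda>x. F x + G x) (\<lambda>x d. F' x d + G' x d)"
proof -
  obtain L where L: "L \<ge> 0" "\<And>x. x \<in> C \<Longrightarrow> norm (F x) \<le> L"
    "\<And>x d. x \<in> C \<Longrightarrow> norm (F' x d) \<le> L * norm d"
    "\<And>x y. x \<in> C \<Longrightarrow> y \<in> C \<Longrightarrow> norm (F y - F x - F' x (y - x)) \<le> L * (norm (y - x))\<^sup>2"
    using quad_approxE[OF F] by metis
  obtain K where K: "K \<ge> 0" "\<And>x. x \<in> C \<Longrightarrow> norm (G x) \<le> K"
    "\<And>x d. x \<in> C \<Longrightarrow> norm (G' x d) \<le> K * norm d"
    "\<And>x y. x \<in> C \<Longrightarrow> y \<in> C \<Longrightarrow> norm (G y - G x - G' x (y - x)) \<le> K * (norm (y - x))\<^sup>2"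
    using quad_approxE[OF G] by metis
  have tri: "norm (a + b) \<le> (L + K) * r" if "norm a \<le> L * r" "norm b \<le> K * r" for a b :: 'b and r
    using norm_triangle_mono[OF that] by (simp add: algebra_simps)
  have rem: "F y + G y - (F x + G x) - (F' x (y - x) + G' x (y - x))
      = (F y - F x - F' x (y - x)) + (G y - G x - G' x (y - x))" for x y
    by simp
  show ?thesis
  proof (rule quad_approxI[of "L + K"])
    show "norm (F x + G x) \<le> L + K" if "x \<in> C" for x
      using norm_triangle_mono[OF L(2)[OF that] K(2)[OF that]] .
    show "norm (F' x d + G' x d) \<le> (L + K) * norm d" if "x \<in> C" for x d
      by (rule tri[OF L(3)[OF that] K(3)[OF that]])
    show "norm (F y + G y - (F x + G x) - (F' x (y - x) + G' x (y - x))) \<le> (L + K) * (norm (y - x))\<^sup>2"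
      if "x \<in> C" "y \<in> C" for x y
      unfolding rem by (rule tri[OF L(4)[OF that] K(4)[OF that]])
  qed (use L K in auto)
qed

lemma quad_approx_minus:
  "quad_approx C F F' \<Longrightarrow> quad_approx C (\<lambda>x. - F x) (\<lambda>x d. - F' x d)"
  by (rule quad_approx_compose[OF bounded_linear_minus[OF bounded_linear_ident]])

lemma quad_approx_diff:
  assumes "quad_approx C F F'" "quad_approx C G G'"
  shows "quad_approx C (\<lambda>x. F x - G x) (\<lambda>x d. F' x d - G' x d)"
  using quad_approx_add[OF assms(1) quad_approx_minus[OF assms(2)]] by simp

lemma quad_approx_Pair:
  assumes "quad_approx C F F'" "quad_approx C G G'"
  shows "quad_approx C (\<lambda>x. (F x, G x)) (\<lambda>x d. (F' x d, G' x d))"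
proof -
  have 1: "bounded_linear (\<lambda>a. (a, 0))" "bounded_linear (\<lambda>b. (0, b))"
    by (intro bounded_linear_Pair bounded_linear_ident bounded_linear_zero)+
  show ?thesis
    using quad_approx_add[OF quad_approx_compose[OF 1(1) assms(1)] quad_approx_compose[OF 1(2) assms(2)]]
    by simp
qed

text \<open>
  The remainder of a product splits as
  \<open>B (rem F) (G y) + B (F' d) (G y - G x) + B (F x) (rem G)\<close>. The middle term is quadratic
  because \<open>G\<close> is Lipschitz, globally on \<open>C\<close>: for \<open>|y - x| \<le> 1\<close> by the expansion, otherwise by
  boundedness.
\<close>

lemma quad_approx_bilinear:
  assumes B: "bounded_bilinear B" and F: "quad_approx C F F'" and G: "quad_approx C G G'"
  shows "quad_approx C (\<lambda>x. B (F x) (G x)) (\<lambda>x d. B (F' x d) (G x) + B (F x) (G' x d))"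
proof -
  interpret B: bounded_bilinear B by (rule B)
  obtain P where P: "P \<ge> 0" "\<And>a b. norm (B a b) \<le> norm a * norm b * P"
    using B.nonneg_bounded by blast
  obtain L where L: "L \<ge> 0" "\<And>x. x \<in> C \<Longrightarrow> norm (F x) \<le> L"
    "\<And>x d. x \<in> C \<Longrightarrow> norm (F' x d) \<le> L * norm d"
    "\<And>x y. x \<in> C \<Longrightarrow> y \<in> C \<Longrightarrow> norm (F y - F x - F' x (y - x)) \<le> L * (norm (y - x))\<^sup>2"
    using quad_approxE[OF F] by metis
  obtain K where K: "K \<ge> 0" "\<And>x. x \<in> C \<Longrightarrow> norm (G x) \<le> K"
    "\<And>x d. x \<in> C \<Longrightarrow> norm (G' x d) \<le> K * norm d"
    "\<And>x y. x \<in> C \<Longrightarrow> y \<in> C \<Longrightarrow> norm (G y - G x - G' x (y - x)) \<le> K * (norm (y - x))\<^sup>2"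
    using quad_approxE[OF G] by metis
  define N where "N = L * K * P"
  have N: "N \<ge> 0" using L K P by (simp add: N_def)
  have bd: "norm (B a b) \<le> N * (r * s)" if "norm a \<le> L * r" "norm b \<le> K * s" for a b r s
  proof -
    have "norm a * norm b \<le> (L * r) * (K * s)"
      by (rule mult_mono[OF that]) (use that norm_ge_zero order_trans in blast)+
    then have "norm a * norm b * P \<le> (L * r) * (K * s) * P" using P(1) by (rule mult_right_mono)
    also have "\<dots> = N * (r * s)" by (simp add: N_def)
    finally show ?thesis using P(2)[of a b] by linarith
  qed
  have lip: "norm (G y - G x) \<le> K * (2 * norm (y - x))" if xy: "x \<in> C" "y \<in> C" for x y
  proof (cases "norm (y - x) \<le> 1")
    case True
    have "norm (G y - G x) \<le> norm (G y - G x - G' x (y - x)) + norm (G' x (y - x))"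
      using norm_triangle_ineq[of "G y - G x - G' x (y - x)" "G' x (y - x)"] by simp
    also have "\<dots> \<le> K * (norm (y - x))\<^sup>2 + K * norm (y - x)"
      using K(3)[OF xy(1)] K(4)[OF xy] by (intro add_mono)
    also have "K * (norm (y - x))\<^sup>2 \<le> K * norm (y - x)"
      using True K(1) by (intro mult_left_mono) (auto simp: power2_eq_square mult_left_le)
    finally show ?thesis by simp
  next
    case False
    have "norm (G y - G x) \<le> norm (G y) + norm (G x)" by (rule norm_triangle_ineq4)
    also have "\<dots> \<le> K * 2" using K(2)[OF xy(1)] K(2)[OF xy(2)] by simp
    also have "\<dots> \<le> K * (2 * norm (y - x))" using False K(1) by (intro mult_left_mono) auto
    finally show ?thesis .
  qed
  show ?thesis
  proof (rule quad_approxI[of "4 * N"])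
    fix x assume x: "x \<in> C"
    show "norm (B (F x) (G x)) \<le> 4 * N"
      using bd[of "F x" 1 "G x" 1] L(2)[OF x] K(2)[OF x] N by simp
    fix d
    have "norm (B (F' x d) (G x) + B (F x) (G' x d)) \<le> N * (norm d * 1) + N * (1 * norm d)"
      using L(2,3)[OF x] K(2,3)[OF x] by (intro norm_triangle_mono bd) auto
    also have "\<dots> \<le> 4 * N * norm d" using N by simp
    finally show "norm (B (F' x d) (G x) + B (F x) (G' x d)) \<le> 4 * N * norm d" .
  next
    fix x y assume xy: "x \<in> C" "y \<in> C"
    define d where "d = y - x"
    have "B (F y) (G y) - B (F x) (G x) - (B (F' x d) (G x) + B (F x) (G' x d))
        = B (F y - F x - F' x d) (G y) + B (F' x d) (G y - G x) + B (F x) (G y - G x - G' x d)"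
      by (simp add: B.diff_left B.diff_right)
    also have "norm \<dots> \<le> N * ((norm d)\<^sup>2 * 1) + N * (norm d * (2 * norm d)) + N * (1 * (norm d)\<^sup>2)"
      unfolding d_def
      by (intro norm_triangle_mono bd L(3,4) K(4) lip xy) (use L(2) K(2) xy in auto)
    also have "\<dots> = 4 * N * (norm d)\<^sup>2" by (simp add: power2_eq_square)
    finally show "norm (B (F y) (G y) - B (F x) (G x) - (B (F' x (y - x)) (G x) + B (F x) (G' x (y - x))))
        \<le> 4 * N * (norm (y - x))\<^sup>2"
      by (simp add: d_def)
  qed (use N in simp)
qed

text \<open>
  The index set \<open>I\<close> may be a closed interval, for the mean value theorem along a segment, or
  an open one, for a two-sided derivative at an interior point.
\<close>

lemma quad_approx_line:
  assumes qa: "quad_approx C F F'" and lin: "linear (F' (x + t *\<^sub>R d))"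
    and I: "\<And>s. s \<in> I \<Longrightarrow> x + s *\<^sub>R d \<in> C" "t \<in> I"
  shows "((\<lambda>s. F (x + s *\<^sub>R d)) has_vector_derivative F' (x + t *\<^sub>R d) d) (at t within I)"
proof -
  obtain L where L: "L \<ge> 0"
    "\<And>x y. x \<in> C \<Longrightarrow> y \<in> C \<Longrightarrow> norm (F y - F x - F' x (y - x)) \<le> L * (norm (y - x))\<^sup>2"
    using quad_approxE[OF qa] by metis
  show ?thesis
    unfolding has_vector_derivative_def
  proof (rule has_derivativeI_sandwich[where e = 1 and H = "\<lambda>s. (L * (norm d)\<^sup>2) * norm (s - t)"])
    show "bounded_linear (\<lambda>h. h *\<^sub>R F' (x + t *\<^sub>R d) d)"
      by (rule bounded_linear_scaleR_left)
    show "((\<lambda>s. (L * (norm d)\<^sup>2) * norm (s - t)) \<longlongrightarrow> 0) (at t within I)"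
      by (auto intro!: tendsto_eq_intros)
    fix s assume s: "s \<in> I" "s \<noteq> t" "dist s t < 1"
    have inC: "x + t *\<^sub>R d \<in> C" "x + s *\<^sub>R d \<in> C" using I s by auto
    have eq: "x + s *\<^sub>R d - (x + t *\<^sub>R d) = (s - t) *\<^sub>R d" by (simp add: algebra_simps)
    have Fl: "F' (x + t *\<^sub>R d) ((s - t) *\<^sub>R d) = (s - t) *\<^sub>R F' (x + t *\<^sub>R d) d"
      by (rule linear_cmul[OF lin])
    have "norm (F (x + s *\<^sub>R d) - F (x + t *\<^sub>R d) - (s - t) *\<^sub>R F' (x + t *\<^sub>R d) d)
        \<le> L * (norm ((s - t) *\<^sub>R d))\<^sup>2"
      using L(2)[OF inC] unfolding eq Fl .
    also have "\<dots> = (L * (norm d)\<^sup>2) * norm (s - t) * norm (s - t)"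
      by (simp add: power_mult_distrib power2_eq_square)
    finally show "norm (F (x + s *\<^sub>R d) - F (x + t *\<^sub>R d) - (s - t) *\<^sub>R F' (x + t *\<^sub>R d) d) / norm (s - t)
        \<le> (L * (norm d)\<^sup>2) * norm (s - t)"
      using s by (simp add: divide_le_eq)
  qed simp
qed

section \<open>Damped Newton steps on a subspace\<close>

lemma convex_segment_in:
  assumes "convex C" "x \<in> C" "x + d \<in> C" "0 \<le> t" "t \<le> (1::real)"
  shows "x + t *\<^sub>R d \<in> C"
proof -
  have "(1 - t) *\<^sub>R x + t *\<^sub>R (x + d) \<in> C"
    using assms by (intro convexD) auto
  then show ?thesis by (simp add: algebra_simps)
qed

text \<open>
  The Newton estimates compare points of a compact set with nearby trial points and with the
  minimizer, along segments. The convex hull of \<open>K\<close> thickened by a small ball of \<open>V\<close> contains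
  all of them and is still a compact subset of the domain.
\<close>

lemma compact_enlarge_in_openin:
  fixes V F K :: "'a::euclidean_space set"
  assumes V: "subspace V" and openin_F: "openin (top_of_set V) F" and convex_F: "convex F"
    and "compact K" "K \<subseteq> F"
  obtains C r where "compact C" "convex C" "C \<subseteq> F" "r > 0" "K \<subseteq> C"
    "\<And>x v. x \<in> K \<Longrightarrow> v \<in> V \<Longrightarrow> norm v \<le> r \<Longrightarrow> x + v \<in> C"
proof -
  have F_sub_V: "F \<subseteq> V" using openin_F openin_imp_subset by blast
  let ?K = "convex hull K"
  have K: "compact ?K" "?K \<subseteq> F" "convex ?K"
    using assms convex_F by (auto intro: compact_convex_hull simp: subset_hull)
  obtain T where T: "open T" "F = V \<inter> T"
    using openin_F by (metis openin_open)
  obtain e where e: "e > 0" "(\<Union>x\<in>?K. ball x e) \<subseteq> T"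
    using compact_subset_open_imp_ball_epsilon_subset[of ?K T] K T by blast
  define r where "r = e / 2"
  let ?B = "V \<inter> cball 0 r"
  let ?C = "\<Union>x\<in>?K. \<Union>y\<in>?B. {x + y}"
  have "closed V" using V by (rule closed_subspace)
  then have cB: "compact ?B" by (simp add: closed_Int_compact)
  have "convex ?B" using V by (simp add: convex_Int subspace_imp_convex)
  show thesis
  proof (rule that[of ?C r])
    show "compact ?C" using compact_sums'[OF K(1) cB] .
    show "convex ?C" using convex_sums[OF K(3) \<open>convex ?B\<close>] .
    show "r > 0" using e by (simp add: r_def)
    have 0: "0 \<in> ?B" using V \<open>r > 0\<close> by (simp add: subspace_0)
    have KC: "K \<subseteq> ?K" by (rule hull_subset)
    show "K \<subseteq> ?C" using 0 KC by force
    show "?C \<subseteq> F"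
    proof clarify
      fix x y assume x: "x \<in> ?K" and y: "y \<in> V" "y \<in> cball 0 r"
      have "x \<in> V" using x K(2) F_sub_V by blast
      then have "x + y \<in> V" using V y by (simp add: subspace_add)
      moreover have "x + y \<in> ball x e" using y e by (simp add: dist_norm r_def)
      ultimately show "x + y \<in> F" using e(2) x T by blast
    qed
    show "x + v \<in> ?C" if "x \<in> K" "v \<in> V" "norm v \<le> r" for x v
    proof -
      have "x \<in> ?K" "v \<in> ?B" using that KC by auto
      then show ?thesis by blast
    qed
  qed
qed

text \<open>
  The gradient \<open>g\<close> and the second derivative \<open>H\<close> take values in the whole space, but only
  their inner products with vectors of \<open>V\<close> matter. The assumption on \<open>stp\<close> describes
  backtracking: if any dyadic step is acceptable, then \<open>stp\<close> is acceptable, dyadic and at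
  least as large.
\<close>

locale damped_newton =
  fixes V F :: "'a::euclidean_space set" and f :: "'a \<Rightarrow> real" and g :: "'a \<Rightarrow> 'a"
    and H :: "'a \<Rightarrow> 'a \<Rightarrow> 'a" and dir :: "'a \<Rightarrow> 'a" and stp :: "'a \<Rightarrow> real" and \<sigma> :: real
  assumes V: "subspace V"
    and openin_F: "openin (top_of_set V) F"
    and convex_F: "convex F"
    and cont_f: "continuous_on F f"
    and deriv: "\<And>x d. x \<in> F \<Longrightarrow> d \<in> V \<Longrightarrow>
      ((\<lambda>t. f (x + t *\<^sub>R d)) has_real_derivative g x \<bullet> d) (at 0)"
    and approx: "\<And>C. compact C \<Longrightarrow> C \<subseteq> F \<Longrightarrow> quad_approx C g H"
    and lin: "\<And>x. x \<in> F \<Longrightarrow> linear (H x)"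
    and coercive: "\<And>C. compact C \<Longrightarrow> C \<subseteq> F \<Longrightarrow> \<exists>m>0. \<forall>x\<in>C. \<forall>d\<in>V. m * (norm d)\<^sup>2 \<le> H x d \<bullet> d"
    and sublevel: "\<And>c. compact {x \<in> F. f x \<le> c}"
    and dir_in: "\<And>x. x \<in> F \<Longrightarrow> dir x \<in> V"
    and dir_eq: "\<And>x v. x \<in> F \<Longrightarrow> v \<in> V \<Longrightarrow> (H x (dir x) + g x) \<bullet> v = 0"
    and stp: "\<And>x m. x \<in> F \<Longrightarrow> x + (1 / 2 ^ m) *\<^sub>R dir x \<in> F \<Longrightarrow>
        f (x + (1 / 2 ^ m) *\<^sub>R dir x) \<le> f x + \<sigma> * (1 / 2 ^ m) * (g x \<bullet> dir x) \<Longrightarrow>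
        (\<exists>n::nat. stp x = 1 / 2 ^ n) \<and> 1 / 2 ^ m \<le> stp x \<and> x + stp x *\<^sub>R dir x \<in> F
        \<and> f (x + stp x *\<^sub>R dir x) \<le> f x + \<sigma> * stp x * (g x \<bullet> dir x)"
    and \<sigma>: "0 < \<sigma>" "\<sigma> < 1 / 2"
begin

lemmas enlarge = compact_enlarge_in_openin[OF V openin_F convex_F]

lemma F_sub_V: "F \<subseteq> V"
  using openin_F openin_imp_subset by blast

lemma gradient_strongly_monotone:
  assumes C: "compact C" "convex C" "C \<subseteq> F"
    and m: "\<And>x d. x \<in> C \<Longrightarrow> d \<in> V \<Longrightarrow> m * (norm d)\<^sup>2 \<le> H x d \<bullet> d"
    and xy: "x \<in> C" "y \<in> C"
  shows "m * (norm (y - x))\<^sup>2 \<le> (g y - g x) \<bullet> (y - x)"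
proof -
  define d where "d = y - x"
  have y: "y = x + d" by (simp add: d_def)
  have dV: "d \<in> V" using xy C(3) F_sub_V V by (auto simp: d_def intro: subspace_diff)
  let ?\<phi> = "\<lambda>t. g (x + t *\<^sub>R d) \<bullet> d"
  have der: "(?\<phi> has_derivative (\<lambda>h. h * (H (x + t *\<^sub>R d) d \<bullet> d))) (at t within {0..1})"
    if t: "0 \<le> t" "t \<le> 1" for t
  proof -
    have seg: "x + s *\<^sub>R d \<in> C" if "s \<in> {0..1}" for s
      using convex_segment_in[OF C(2)] xy y that by auto
    have "((\<lambda>s. g (x + s *\<^sub>R d)) has_vector_derivative H (x + t *\<^sub>R d) d) (at t within {0..1})"
      by (rule quad_approx_line[OF approx[OF C(1,3)] lin seg]) (use t seg C(3) in auto)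
    then have "(?\<phi> has_vector_derivative H (x + t *\<^sub>R d) d \<bullet> d) (at t within {0..1})"
      by (rule bounded_linear.has_vector_derivative[OF bounded_linear_inner_left])
    then show ?thesis by (simp add: has_vector_derivative_def)
  qed
  obtain t where t: "t \<in> {0..1}" "?\<phi> 1 - ?\<phi> 0 = (1 - 0) * (H (x + t *\<^sub>R d) d \<bullet> d)"
    using mvt_very_simple[of 0 1 ?\<phi> "\<lambda>t h. h * (H (x + t *\<^sub>R d) d \<bullet> d)"] der by auto
  have "x + t *\<^sub>R d \<in> C" using convex_segment_in[OF C(2)] xy y t by auto
  then show ?thesis using t m[of "x + t *\<^sub>R d" d] dV by (simp add: d_def inner_diff_left)
qed

text \<open>
  Apply the mean value theorem to \<open>f\<close> minus its second-order Taylor polynomial along the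
  segment; the derivative of the difference is the remainder of \<open>g\<close>, of size \<open>L |d|\<^sup>2\<close>,
  paired with \<open>d\<close>.
\<close>

lemma objective_expansion:
  assumes C: "convex C" "C \<subseteq> F"
    and L: "\<And>x y. x \<in> C \<Longrightarrow> y \<in> C \<Longrightarrow> norm (g y - g x - H x (y - x)) \<le> L * (norm (y - x))\<^sup>2"
    and L0: "L \<ge> 0"
    and x: "x \<in> C" "x + d \<in> C"
  shows "f (x + d) \<le> f x + g x \<bullet> d + 1 / 2 * (H x d \<bullet> d) + L * norm d ^ 3"
proof -
  have dV: "d \<in> V" using x C(2) F_sub_V V by (metis add_diff_cancel_left' subsetD subspace_diff)
  let ?a = "g x \<bullet> d" and ?b = "H x d \<bullet> d"
  let ?\<psi> = "\<lambda>t. f (x + t *\<^sub>R d) - ?a * t - ?b / 2 * t\<^sup>2"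
  have der: "DERIV ?\<psi> t :> g (x + t *\<^sub>R d) \<bullet> d - ?a - ?b * t" if t: "0 \<le> t" "t \<le> 1" for t
  proof -
    have "x + t *\<^sub>R d \<in> F" using convex_segment_in[OF C(1)] x t C(2) by auto
    from deriv[OF this dV] have "((\<lambda>s. f (x + (t + s) *\<^sub>R d)) has_real_derivative g (x + t *\<^sub>R d) \<bullet> d) (at 0)"
      by (simp add: algebra_simps)
    then have "((\<lambda>s. f (x + s *\<^sub>R d)) has_real_derivative g (x + t *\<^sub>R d) \<bullet> d) (at t)"
      using DERIV_shift[of "\<lambda>s. f (x + s *\<^sub>R d)" _ 0 t] by (simp add: add.commute)
    then show ?thesis by (auto intro!: derivative_eq_intros)
  qed
  obtain t where t: "0 < t" "t < 1" "?\<psi> 1 - ?\<psi> 0 = (1 - 0) * (g (x + t *\<^sub>R d) \<bullet> d - ?a - ?b * t)"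
    using MVT2[of 0 1 ?\<psi> "\<lambda>t. g (x + t *\<^sub>R d) \<bullet> d - ?a - ?b * t"] der by auto
  have inC: "x + t *\<^sub>R d \<in> C" using convex_segment_in[OF C(1)] x t by auto
  have Hl: "H x (t *\<^sub>R d) = t *\<^sub>R H x d"
    using lin[of x] x C(2) by (blast intro: linear_cmul)
  have "g (x + t *\<^sub>R d) \<bullet> d - ?a - ?b * t = (g (x + t *\<^sub>R d) - g x - H x (x + t *\<^sub>R d - x)) \<bullet> d"
    by (simp add: Hl inner_diff_left)
  also have "\<dots> \<le> norm (g (x + t *\<^sub>R d) - g x - H x (x + t *\<^sub>R d - x)) * norm d"
    by (rule norm_cauchy_schwarz)
  also have "\<dots> \<le> (L * (norm (x + t *\<^sub>R d - x))\<^sup>2) * norm d"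
    using L[OF x(1) inC] by (intro mult_right_mono) auto
  also have "\<dots> = t\<^sup>2 * (L * norm d ^ 3)"
    by (simp add: power_mult_distrib power2_eq_square power3_eq_cube)
  also have "\<dots> \<le> 1 * (L * norm d ^ 3)"
    using t L0 by (intro mult_right_mono) (auto simp: power_le_one)
  finally show ?thesis using t(3) by simp
qed

lemma stationary_if_minimal:
  assumes x: "x \<in> F" and min: "\<And>y. y \<in> F \<Longrightarrow> f x \<le> f y" and v: "v \<in> V"
  shows "g x \<bullet> v = 0"
proof -
  have "{x} \<subseteq> F" using x by simp
  then obtain C r where C: "C \<subseteq> F" "r > 0"
    "\<And>y v. y \<in> {x} \<Longrightarrow> v \<in> V \<Longrightarrow> norm v \<le> r \<Longrightarrow> y + v \<in> C"
    using enlarge[OF compact_sing] by metis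
  show ?thesis
  proof (rule DERIV_local_min[OF deriv[OF x v]])
    let ?e = "r / (norm v + 1)"
    show "0 < ?e" using C(2) by (simp add: add_nonneg_pos)
    show "\<forall>t. \<bar>0 - t\<bar> < ?e \<longrightarrow> f (x + 0 *\<^sub>R v) \<le> f (x + t *\<^sub>R v)"
    proof (intro allI impI)
      fix t assume t: "\<bar>0 - t\<bar> < ?e"
      have "norm (t *\<^sub>R v) \<le> \<bar>t\<bar> * (norm v + 1)" by (simp add: mult_left_mono)
      also have "\<dots> \<le> r" using t by (simp add: pos_less_divide_eq add_nonneg_pos)
      finally have "x + t *\<^sub>R v \<in> C" using C(3)[of x "t *\<^sub>R v"] v V by (simp add: subspace_scale)
      then show "f (x + 0 *\<^sub>R v) \<le> f (x + t *\<^sub>R v)" using min C(1) by auto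
    qed
  qed
qed

text \<open>
  All estimates are made on one compact convex set \<open>C\<close> around the sublevel set \<open>K\<close> of the
  initial point, where \<open>m\<close> bounds the second derivative from below and \<open>L\<close> bounds
  everything else from above.
\<close>

theorem convergence:
  assumes z0: "z 0 \<in> F" and iter: "\<And>t. z (Suc t) = z t + stp (z t) *\<^sub>R dir (z t)"
  obtains zs where "\<And>x. is_arg_min f (\<lambda>x. x \<in> F) x \<longleftrightarrow> x = zs" "z \<longlonglongrightarrow> zs"
    "locally_quadratic_convergence z zs"
proof -
  define K where "K = {x \<in> F. f x \<le> f (z 0)}"
  have K: "compact K" "K \<subseteq> F" "z 0 \<in> K" using sublevel z0 by (auto simp: K_def)
  obtain C r where C: "compact C" "convex C" "C \<subseteq> F" and r: "r > 0" and KC: "K \<subseteq> C"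
    and KrC: "\<And>x v. x \<in> K \<Longrightarrow> v \<in> V \<Longrightarrow> norm v \<le> r \<Longrightarrow> x + v \<in> C"
    using enlarge[OF K(1,2)] by metis
  obtain L where L: "L \<ge> 0" "\<And>x. x \<in> C \<Longrightarrow> norm (g x) \<le> L"
    "\<And>x d. x \<in> C \<Longrightarrow> norm (H x d) \<le> L * norm d"
    "\<And>x y. x \<in> C \<Longrightarrow> y \<in> C \<Longrightarrow> norm (g y - g x - H x (y - x)) \<le> L * (norm (y - x))\<^sup>2"
    using quad_approxE[OF approx[OF C(1,3)]] by metis
  obtain m where m: "m > 0" "\<And>x d. x \<in> C \<Longrightarrow> d \<in> V \<Longrightarrow> m * (norm d)\<^sup>2 \<le> H x d \<bullet> d"
    using coercive[OF C(1,3)] by metis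
  note mono = gradient_strongly_monotone[OF C m(2)]
  have KF: "x \<in> F" and KC': "x \<in> C" if "x \<in> K" for x using that K KC by auto

  obtain zs where zs: "zs \<in> K" "\<And>y. y \<in> K \<Longrightarrow> f zs \<le> f y"
    using continuous_attains_inf[of K f] K continuous_on_subset[OF cont_f K(2)] by blast
  have zs_min: "f zs \<le> f y" if "y \<in> F" for y
    using zs that z0 K(3) unfolding K_def by fastforce
  have zs_stat: "g zs \<bullet> v = 0" if "v \<in> V" for v
    using stationary_if_minimal[OF KF[OF zs(1)] zs_min that] .
  have unique: "is_arg_min f (\<lambda>x. x \<in> F) x \<longleftrightarrow> x = zs" for x
  proof
    assume "x = zs"
    then show "is_arg_min f (\<lambda>x. x \<in> F) x"
      using zs_min KF[OF zs(1)] by (auto simp: is_arg_min_def not_less)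
  next
    assume "is_arg_min f (\<lambda>x. x \<in> F) x"
    then have x: "x \<in> F" and xmin: "\<And>y. y \<in> F \<Longrightarrow> f x \<le> f y" by (auto simp: is_arg_min_def not_less)
    have xK: "x \<in> K" using x xmin[OF z0] by (simp add: K_def)
    have d: "x - zs \<in> V" using x KF[OF zs(1)] F_sub_V V by (auto intro: subspace_diff)
    have "m * (norm (x - zs))\<^sup>2 \<le> (g x - g zs) \<bullet> (x - zs)"
      by (rule mono) (use xK zs KC in auto)
    also have "\<dots> = 0"
      using zs_stat[OF d] stationary_if_minimal[OF x xmin d] by (simp add: inner_diff_left)
    finally show "x = zs" using m(1) by (simp add: mult_le_0_iff)
  qed

  have slope: "H x (dir x) \<bullet> dir x = - (g x \<bullet> dir x)" if "x \<in> K" for x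
    using dir_eq[OF KF[OF that] dir_in[OF KF[OF that]]] by (simp add: inner_add_left)
  have descent: "m * (norm (dir x))\<^sup>2 \<le> - (g x \<bullet> dir x)" if "x \<in> K" for x
    using m(2)[OF KC'[OF that] dir_in[OF KF[OF that]]] slope[OF that] by simp
  have dir_bound: "norm (dir x) \<le> L / m" if "x \<in> K" for x
  proof -
    have "m * (norm (dir x))\<^sup>2 \<le> norm (g x) * norm (dir x)"
      using descent[OF that] Cauchy_Schwarz_ineq2[of "g x" "dir x"] by linarith
    also have "\<dots> \<le> L * norm (dir x)" using L(2)[OF KC'[OF that]] by (intro mult_right_mono) auto
    finally have "(m * norm (dir x)) * norm (dir x) \<le> L * norm (dir x)" by (simp add: power2_eq_square)
    then have "m * norm (dir x) \<le> L" using L(1) by (cases "dir x = 0") auto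
    then show ?thesis using m(1) by (simp add: field_simps)
  qed
  \<comment> \<open>Along the direction, \<open>H d \<bullet> d\<close> is minus the slope, and \<open>|d|\<^sup>2\<close> is at most minus the slope
    divided by \<open>m\<close>; so the second- and third-order terms are fractions of the predicted decrease.\<close>
  have accept: "x + s *\<^sub>R dir x \<in> F \<and> f (x + s *\<^sub>R dir x) \<le> f x + \<sigma> * s * (g x \<bullet> dir x)"
    if x: "x \<in> K" and s: "s > 0" "s * norm (dir x) \<le> r"
      "s * (1 / 2 + L * (s * norm (dir x)) / m) \<le> 1 - \<sigma>" for x s
  proof -
    let ?d = "dir x" and ?\<delta> = "g x \<bullet> dir x"
    have "s *\<^sub>R ?d \<in> V" using dir_in[OF KF[OF x]] V by (simp add: subspace_scale)
    then have inC: "x + s *\<^sub>R ?d \<in> C" using KrC[OF x] s by simp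
    have Hl: "H x (s *\<^sub>R ?d) = s *\<^sub>R H x ?d" using lin[OF KF[OF x]] by (rule linear_cmul)
    have "f (x + s *\<^sub>R ?d) \<le> f x + g x \<bullet> (s *\<^sub>R ?d) + 1 / 2 * (H x (s *\<^sub>R ?d) \<bullet> (s *\<^sub>R ?d)) + L * norm (s *\<^sub>R ?d) ^ 3"
      by (rule objective_expansion[OF C(2,3) L(4,1)]) (use KC' x inC in auto)
    also have "\<dots> = f x + s * ?\<delta> + 1 / 2 * s\<^sup>2 * (- ?\<delta>) + L * (s * norm ?d) ^ 3"
      using s by (simp add: Hl slope[OF x] power2_eq_square)
    also have "L * (s * norm ?d) ^ 3 = s\<^sup>2 * (L * (s * norm ?d) / m) * (m * (norm ?d)\<^sup>2)"
      using m(1) by (simp add: power_mult_distrib power2_eq_square power3_eq_cube)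
    also have "\<dots> \<le> s\<^sup>2 * (L * (s * norm ?d) / m) * (- ?\<delta>)"
      using descent[OF x] s L(1) m(1) by (intro mult_left_mono) auto
    finally have "f (x + s *\<^sub>R ?d) \<le> f x + s * ?\<delta> + (s * (- ?\<delta>)) * (s * (1 / 2 + L * (s * norm ?d) / m))"
      by (simp add: algebra_simps power2_eq_square)
    also have "(s * (- ?\<delta>)) * (s * (1 / 2 + L * (s * norm ?d) / m)) \<le> (s * (- ?\<delta>)) * (1 - \<sigma>)"
    proof (rule mult_left_mono[OF s(3)])
      have "0 \<le> m * (norm ?d)\<^sup>2" using m(1) by simp
      then have "0 \<le> - ?\<delta>" using descent[OF x] by linarith
      then show "0 \<le> s * (- ?\<delta>)" using s(1) by (intro mult_nonneg_nonneg) auto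
    qed
    finally have "f (x + s *\<^sub>R ?d) \<le> f x + \<sigma> * s * ?\<delta>" by (simp add: algebra_simps)
    then show ?thesis using inC C(3) by auto
  qed

  \<comment> \<open>A step \<open>s\<close> with \<open>s |d| \<le> r\<close> is acceptable as soon as \<open>s B \<le> 1 - \<sigma>\<close>; since \<open>|d| \<le> L / m\<close>,
    one dyadic \<open>\<beta>\<close> works at all points of \<open>K\<close>. The summand \<open>1\<close> in \<open>L / m + 1\<close> only avoids
    dividing by zero.\<close>
  define B where "B = 1 / 2 + L * r / m"
  have B: "B > 0" using L(1) r m(1) by (simp add: B_def add_pos_nonneg)
  obtain n0 where n0: "(1 / 2 :: real) ^ n0 < min (r / (L / m + 1)) ((1 - \<sigma>) / B)"
    using real_arch_pow_inv[of "min (r / (L / m + 1)) ((1 - \<sigma>) / B)" "1 / 2"] r B \<sigma> L(1) m(1)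
    by (auto simp: add_nonneg_pos)
  define \<beta> :: real where "\<beta> = 1 / 2 ^ n0"
  have \<beta>: "\<beta> > 0" "\<beta> * (L / m + 1) \<le> r" "\<beta> * B \<le> 1 - \<sigma>"
  proof -
    have eq: "\<beta> = (1 / 2) ^ n0" by (simp add: \<beta>_def power_divide)
    show "\<beta> > 0" by (simp add: \<beta>_def)
    have "L / m + 1 > 0" using L(1) m(1) by (simp add: add_nonneg_pos)
    then show "\<beta> * (L / m + 1) \<le> r" using n0 eq by (simp add: pos_less_divide_eq)
    show "\<beta> * B \<le> 1 - \<sigma>" using n0 eq B by (simp add: pos_less_divide_eq)
  qed
  have step: "\<beta> \<le> stp x \<and> x + stp x *\<^sub>R dir x \<in> F
      \<and> f (x + stp x *\<^sub>R dir x) \<le> f x + \<sigma> * stp x * (g x \<bullet> dir x)" if x: "x \<in> K" for x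
  proof -
    have "\<beta> * norm (dir x) \<le> \<beta> * (L / m + 1)"
      using dir_bound[OF x] \<beta>(1) by (intro mult_left_mono) auto
    then have 1: "\<beta> * norm (dir x) \<le> r" using \<beta>(2) by linarith
    have "\<beta> * (1 / 2 + L * (\<beta> * norm (dir x)) / m) \<le> \<beta> * B"
      unfolding B_def using 1 \<beta>(1) L(1) m(1)
      by (intro mult_left_mono add_left_mono divide_right_mono) auto
    then have 2: "\<beta> * (1 / 2 + L * (\<beta> * norm (dir x)) / m) \<le> 1 - \<sigma>" using \<beta>(3) by linarith
    show ?thesis
      using accept[OF x \<beta>(1) 1 2] stp[OF KF[OF x], of n0] by (simp add: \<beta>_def)
  qed
  have decr: "x + stp x *\<^sub>R dir x \<in> K \<and>
      \<sigma> * \<beta> * m * (norm (dir x))\<^sup>2 \<le> f x - f (x + stp x *\<^sub>R dir x)" if x: "x \<in> K" for x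
  proof -
    have "\<sigma> * \<beta> * (m * (norm (dir x))\<^sup>2) \<le> \<sigma> * stp x * (- (g x \<bullet> dir x))"
      using step[OF x] \<sigma> \<beta>(1) m(1) descent[OF x] by (intro mult_mono mult_left_mono) auto
    then have *: "\<sigma> * \<beta> * m * (norm (dir x))\<^sup>2 \<le> f x - f (x + stp x *\<^sub>R dir x)"
      using step[OF x] by (simp add: algebra_simps)
    moreover have "0 \<le> \<sigma> * \<beta> * m * (norm (dir x))\<^sup>2" using \<sigma> \<beta>(1) m(1) by simp
    ultimately have "f (x + stp x *\<^sub>R dir x) \<le> f (z 0)" using x by (simp add: K_def)
    then show ?thesis using * step[OF x] by (simp add: K_def)
  qed
  have zK: "z t \<in> K" for t
    by (induction t) (use K(3) decr iter in auto)
  have decr_z: "\<sigma> * \<beta> * m * (norm (dir (z t)))\<^sup>2 \<le> f (z t) - f (z (Suc t))" for t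
    using decr[OF zK[of t]] by (simp add: iter)
  have c0: "\<sigma> * \<beta> * m > 0" using \<sigma> \<beta>(1) m(1) by simp
  have "decseq (\<lambda>t. f (z t))"
  proof (rule decseq_SucI)
    fix t
    have "0 \<le> \<sigma> * \<beta> * m * (norm (dir (z t)))\<^sup>2" using c0 by simp
    then show "f (z (Suc t)) \<le> f (z t)" using decr_z[of t] by linarith
  qed
  then obtain l where l: "(\<lambda>t. f (z t)) \<longlonglongrightarrow> l"
    using decseq_convergent[of "\<lambda>t. f (z t)" "f zs"] zs_min KF[OF zK] by metis
  have "(\<lambda>t. (f (z t) - f (z (Suc t))) / (\<sigma> * \<beta> * m)) \<longlonglongrightarrow> (l - l) / (\<sigma> * \<beta> * m)"
    using c0 by (intro tendsto_intros l LIMSEQ_Suc[OF l]) auto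
  then have lim0: "(\<lambda>t. (f (z t) - f (z (Suc t))) / (\<sigma> * \<beta> * m)) \<longlonglongrightarrow> 0" by simp
  have "(\<lambda>t. (norm (dir (z t)))\<^sup>2) \<longlonglongrightarrow> 0"
    by (rule tendsto_sandwich[OF _ _ tendsto_const lim0])
      (use decr_z c0 in \<open>auto simp: pos_le_divide_eq mult.commute\<close>)
  then have "(\<lambda>t. sqrt ((norm (dir (z t)))\<^sup>2)) \<longlonglongrightarrow> sqrt 0" by (rule tendsto_real_sqrt)
  then have dir0: "(\<lambda>t. norm (dir (z t))) \<longlonglongrightarrow> 0" by simp

  \<comment> \<open>The Newton equation turns a small direction into a small residual, and strong monotonicity
    turns a small residual into a small distance to the stationary point \<open>zs\<close>.\<close>
  have zs_diff: "x - zs \<in> V" if "x \<in> K" for x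
    using KF[OF that] KF[OF zs(1)] F_sub_V V by (auto intro: subspace_diff)
  have dist_dir: "norm (x - zs) \<le> L / m * norm (dir x)" if x: "x \<in> K" for x
  proof -
    have v: "x - zs \<in> V" by (rule zs_diff[OF x])
    have "m * (norm (x - zs))\<^sup>2 \<le> (g x - g zs) \<bullet> (x - zs)"
      by (rule mono) (use x zs KC in auto)
    also have "\<dots> = - (H x (dir x) \<bullet> (x - zs))"
      using zs_stat[OF v] dir_eq[OF KF[OF x] v] by (simp add: inner_diff_left inner_add_left)
    also have "\<dots> \<le> norm (H x (dir x)) * norm (x - zs)"
      using Cauchy_Schwarz_ineq2[of "H x (dir x)" "x - zs"] by linarith
    also have "\<dots> \<le> (L * norm (dir x)) * norm (x - zs)"
      using L(3)[OF KC'[OF x]] by (intro mult_right_mono) auto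
    finally have "(m * norm (x - zs)) * norm (x - zs) \<le> (L * norm (dir x)) * norm (x - zs)"
      by (simp add: power2_eq_square)
    then have "m * norm (x - zs) \<le> L * norm (dir x)" using L(1) by (cases "x = zs") auto
    then show ?thesis using m(1) by (simp add: field_simps)
  qed
  have "(\<lambda>t. L / m * norm (dir (z t))) \<longlonglongrightarrow> L / m * 0" by (intro tendsto_intros dir0)
  then have "(\<lambda>t. L / m * norm (dir (z t))) \<longlonglongrightarrow> 0" by simp
  then have lim_dir: "(\<lambda>t. L / m * norm (dir (z t))) \<longlonglongrightarrow> 0" by simp
  have "\<forall>t. dist (z t) zs \<le> L / m * norm (dir (z t))"
    using dist_dir[OF zK] by (simp add: dist_norm)
  then have ub: "\<forall>\<^sub>F t in sequentially. dist (z t) zs \<le> L / m * norm (dir (z t))"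
    by (rule always_eventually)
  have "(\<lambda>t. dist (z t) zs) \<longlonglongrightarrow> 0"
    by (rule tendsto_sandwich[OF _ ub tendsto_const lim_dir]) simp
  then have conv: "z \<longlonglongrightarrow> zs" by (rule tendsto_dist_iff[THEN iffD2])

  \<comment> \<open>This is where \<open>\<sigma> < 1 / 2\<close> enters: the quadratic model decreases by exactly half the slope.\<close>
  have full: "stp x = 1" if x: "x \<in> K" and small: "norm (dir x) \<le> r" "L * norm (dir x) / m \<le> 1 / 2 - \<sigma>" for x
  proof -
    have acc: "x + (1 / 2 ^ 0) *\<^sub>R dir x \<in> F \<and>
        f (x + (1 / 2 ^ 0) *\<^sub>R dir x) \<le> f x + \<sigma> * (1 / 2 ^ 0) * (g x \<bullet> dir x)"
      using accept[OF x, of 1] small by simp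
    then obtain n where n: "stp x = 1 / 2 ^ n" "1 \<le> stp x"
      using stp[OF KF[OF x], of 0] by auto
    have "stp x \<le> 1" unfolding n(1) by simp
    with n(2) show ?thesis by simp
  qed
  \<comment> \<open>The Newton equation and \<open>g zs = 0\<close> on \<open>V\<close> show that \<open>H x\<close> maps the new error to the
    remainder of \<open>g\<close> between \<open>x\<close> and \<open>zs\<close>.\<close>
  have quad: "norm (x + dir x - zs) \<le> L / m * (norm (x - zs))\<^sup>2" if x: "x \<in> K" for x
  proof -
    define e where "e = x + dir x - zs"
    have v: "e \<in> V"
      using zs_diff[OF x] dir_in[OF KF[OF x]] V subspace_add[of V "x - zs" "dir x"]
      by (simp add: e_def algebra_simps)
    have He: "H x e = H x (dir x) - H x (zs - x)"
      using linear_diff[OF lin[OF KF[OF x]], of "dir x" "zs - x"] by (simp add: e_def algebra_simps)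
    have "m * (norm e)\<^sup>2 \<le> H x e \<bullet> e" by (rule m(2)[OF KC'[OF x] v])
    also have "\<dots> = (g zs - g x - H x (zs - x)) \<bullet> e"
      using zs_stat[OF v] dir_eq[OF KF[OF x] v] by (simp add: He inner_diff_left inner_add_left)
    also have "\<dots> \<le> norm (g zs - g x - H x (zs - x)) * norm e" by (rule norm_cauchy_schwarz)
    also have "\<dots> \<le> (L * (norm (zs - x))\<^sup>2) * norm e"
      using L(4)[OF KC'[OF x] KC'[OF zs(1)]] by (intro mult_right_mono) auto
    finally have "(m * norm e) * norm e \<le> (L * (norm (x - zs))\<^sup>2) * norm e"
      by (simp add: power2_eq_square norm_minus_commute)
    then have "m * norm e \<le> L * (norm (x - zs))\<^sup>2" using L(1) by (cases "e = 0") auto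
    then show ?thesis using m(1) by (simp add: field_simps e_def)
  qed
  have "(\<lambda>t. L * norm (dir (z t)) / m) \<longlonglongrightarrow> L * 0 / m"
    using m(1) by (intro tendsto_intros dir0) auto
  then have "\<forall>\<^sub>F t in sequentially. L * norm (dir (z t)) / m < 1 / 2 - \<sigma>"
    by (rule order_tendstoD(2)) (use \<sigma> in auto)
  moreover have "\<forall>\<^sub>F t in sequentially. norm (dir (z t)) < r"
    by (rule order_tendstoD(2)[OF dir0 r])
  ultimately have "\<forall>\<^sub>F t in sequentially. dist (z (Suc t)) zs \<le> L / m * (dist (z t) zs)\<^sup>2"
  proof eventually_elim
    case (elim t)
    then show ?case
      using quad[OF zK[of t]] full[OF zK[of t]] by (simp add: iter dist_norm)
  qed
  then have "locally_quadratic_convergence z zs"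
    unfolding locally_quadratic_convergence_def eventually_sequentially by blast
  with that unique conv show thesis by blast
qed

end

section \<open>Positive definite matrices\<close>

lemma matrix_add_rdistrib: "(A + B) ** C = A ** C + B ** (C :: real^'n^'k)"
  by (vector matrix_matrix_mult_def sum.distrib[symmetric] distrib_right)

lemma bounded_bilinear_matrix_mult:
  "bounded_bilinear ((**) :: real^'n^'m \<Rightarrow> real^'k^'n \<Rightarrow> real^'k^'m)"
proof (rule bilinear_conv_bounded_bilinear[THEN iffD1])
  show "bilinear ((**) :: real^'n^'m \<Rightarrow> real^'k^'n \<Rightarrow> real^'k^'m)"
    unfolding bilinear_def
    by (auto intro!: linearI simp: matrix_add_ldistrib matrix_scalar_ac matrix_add_rdistrib
        scalar_matrix_assoc)
qed

definition pos_semidef :: "real^'p::finite^'p \<Rightarrow> bool" where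
  "pos_semidef A \<longleftrightarrow> sym_mat A \<and> (\<forall>x. 0 \<le> x \<bullet> (A *v x))"

lemma pos_def_imp_semidef: "pos_def A \<Longrightarrow> pos_semidef A"
  unfolding pos_def_def pos_semidef_def by (metis inner_zero_left less_eq_real_def)

lemma matrix_mult_ldistrib_diff: "A ** (B - C) = A ** B - A ** (C :: real^'n^'k)"
  by (rule bounded_bilinear.diff_right[OF bounded_bilinear_matrix_mult])

lemma matrix_mult_rdistrib_diff: "(A - B) ** C = A ** C - B ** (C :: real^'n^'k)"
  by (rule bounded_bilinear.diff_left[OF bounded_bilinear_matrix_mult])

lemma linear_trace: "linear (trace :: real^'n^'n \<Rightarrow> real)"
  by (auto intro!: linearI simp: trace_def sum.distrib sum_distrib_left)

lemma trace_scaleR: "trace (c *\<^sub>R A) = c * trace (A :: real^'n^'n)"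
  using linear_cmul[OF linear_trace] by auto

lemma trace_minus: "trace (- A) = - trace (A :: real^'n^'n)"
  using linear_neg[OF linear_trace] by auto

lemma matrix_mult_scaleR_left: "(k *\<^sub>R A) ** B = k *\<^sub>R (A ** (B :: real^'n^'k))"
  by (rule bounded_bilinear.scaleR_left[OF bounded_bilinear_matrix_mult])

lemma matrix_mult_scaleR_right: "A ** (k *\<^sub>R B) = k *\<^sub>R (A ** (B :: real^'n^'k))"
  by (rule bounded_bilinear.scaleR_right[OF bounded_bilinear_matrix_mult])

lemma matrix_mult_minus_left: "(- A) ** B = - (A ** (B :: real^'n^'k))"
  by (rule bounded_bilinear.minus_left[OF bounded_bilinear_matrix_mult])

lemma matrix_mult_minus_right: "A ** (- B) = - (A ** (B :: real^'n^'k))"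
  by (rule bounded_bilinear.minus_right[OF bounded_bilinear_matrix_mult])

lemmas matrix_expand =
  matrix_add_ldistrib matrix_add_rdistrib matrix_mult_ldistrib_diff matrix_mult_rdistrib_diff
  matrix_mult_scaleR_left matrix_mult_scaleR_right matrix_mult_minus_left matrix_mult_minus_right
  scaleR_add_right scaleR_diff_right scaleR_scaleR
  matrix_mul_assoc[symmetric] matrix_mul_lid matrix_mul_rid

lemmas trace_expand = trace_add trace_sub trace_scaleR trace_minus

lemma transpose_add: "transpose (A + B) = transpose A + transpose (B :: real^'n^'m)"
  by (simp add: transpose_def vec_eq_iff)

lemma transpose_diff: "transpose (A - B) = transpose A - transpose (B :: real^'n^'m)"
  by (simp add: transpose_def vec_eq_iff)

lemma transpose_minus: "transpose (- B) = - transpose (B :: real^'n^'m)"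
  by (simp add: transpose_def vec_eq_iff)

lemmas transpose_expand = transpose_add transpose_diff transpose_minus transpose_scalar transpose_mat
  matrix_transpose_mul

lemma mat_eq_scaleR: "mat c = c *\<^sub>R (mat 1 :: real^'n^'n)"
  by (simp add: mat_def vec_eq_iff)

lemma mat_vec_mult: "mat c *v x = c *\<^sub>R (x :: real^'n)"
  by (simp add: vec_eq_iff mat_def matrix_vector_mult_def if_distrib if_distribR cong: if_cong)

lemma trace_transpose: "trace (transpose A) = trace (A :: real^'n^'n)"
  by (simp add: trace_def transpose_def)

lemma inner_eq_trace: "A \<bullet> B = trace (transpose A ** (B :: real^'n^'m))"
  by (simp add: inner_vec_def trace_def transpose_def matrix_matrix_mult_def)
    (rule sum.swap)

lemma sym_mat_inner: "sym_mat A \<Longrightarrow> x \<bullet> (A *v y) = (A *v x) \<bullet> y"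
  by (metis dot_lmul_matrix sym_mat_def vector_transpose_matrix)

lemma trace_eq_sum: "trace A = (\<Sum>i\<in>UNIV. axis i 1 \<bullet> (A *v axis i (1::real)))"
  by (simp add: trace_def inner_axis' matrix_vector_mult_basis column_def)

lemma pos_semidef_congruence:
  assumes "pos_semidef B"
  shows "pos_semidef (transpose Q ** B ** Q)"
  unfolding pos_semidef_def
proof
  show "sym_mat (transpose Q ** B ** Q)"
    using assms by (simp add: pos_semidef_def sym_mat_def matrix_transpose_mul matrix_mul_assoc)
  have "x \<bullet> (transpose Q ** B ** Q *v x) = (Q *v x) \<bullet> (B *v (Q *v x))" for x
    by (metis dot_lmul_matrix inner_commute matrix_vector_mul_assoc transpose_matrix_vector)
  then show "\<forall>x. 0 \<le> x \<bullet> (transpose Q ** B ** Q *v x)"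
    using assms by (simp add: pos_semidef_def)
qed

text \<open>
  Nonnegativity of the quadratic form at \<open>s x + t y\<close>, with \<open>(s, t) = (c, -b)\<close> where
  \<open>c = y \<bullet> A y\<close> and \<open>b = x \<bullet> A y\<close>; if \<open>c = 0\<close>, the form would be negative for a suitable
  \<open>t\<close> unless \<open>b = 0\<close>.
\<close>

lemma pos_semidef_Cauchy_Schwarz:
  assumes A: "pos_semidef A"
  shows "(x \<bullet> (A *v y))\<^sup>2 \<le> (x \<bullet> (A *v x)) * (y \<bullet> (A *v y))"
proof -
  let ?a = "x \<bullet> (A *v x)" and ?b = "x \<bullet> (A *v y)" and ?c = "y \<bullet> (A *v y)"
  have sym: "y \<bullet> (A *v x) = ?b"
    using A sym_mat_inner[of A y x] by (simp add: pos_semidef_def inner_commute)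
  have q: "0 \<le> s\<^sup>2 * ?a + 2 * s * t * ?b + t\<^sup>2 * ?c" for s t
  proof -
    have "0 \<le> (s *\<^sub>R x + t *\<^sub>R y) \<bullet> (A *v (s *\<^sub>R x + t *\<^sub>R y))" using A by (simp add: pos_semidef_def)
    also have "\<dots> = s\<^sup>2 * ?a + 2 * s * t * ?b + t\<^sup>2 * ?c"
      by (simp add: matrix_vector_right_distrib matrix_vector_mult_scaleR inner_add_left inner_add_right
          sym power2_eq_square algebra_simps)
    finally show ?thesis .
  qed
  have a: "0 \<le> ?a" and c: "0 \<le> ?c" using A by (auto simp: pos_semidef_def)
  show ?thesis
  proof (cases "?c = 0")
    case True
    have "?b = 0"
    proof (rule ccontr)
      assume b: "?b \<noteq> 0"
      have "0 \<le> ?a + 2 * (- (?a + 1) / ?b) * ?b" using q[of 1 "- (?a + 1) / ?b"] True by simp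
      then show False using b a by simp
    qed
    then show ?thesis using True by simp
  next
    case False
    have "0 \<le> ?c * (?c * ?a - ?b\<^sup>2)"
      using q[of ?c "- ?b"] by (simp add: power2_eq_square algebra_simps)
    then have "0 \<le> ?c * ?a - ?b\<^sup>2" using False c by (simp add: zero_le_mult_iff)
    then show ?thesis by (simp add: mult.commute)
  qed
qed

lemma pos_semidef_null:
  assumes A: "pos_semidef A" and x: "x \<bullet> (A *v x) = 0"
  shows "A *v x = 0"
proof -
  have "((A *v x) \<bullet> (A *v x))\<^sup>2 \<le> 0"
    using pos_semidef_Cauchy_Schwarz[OF A, of "A *v x" x] x by simp
  then show ?thesis by simp
qed

lemma diag_eq: "axis i 1 \<bullet> (A *v axis i 1) = (A :: real^'n^'n) $ i $ i"
  by (simp add: inner_axis' matrix_vector_mult_basis column_def)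

lemma trace_rank_one_mult:
  "trace ((\<chi> k l. u $ k * u $ l / a) ** C) = (u \<bullet> (C *v u)) / (a::real)"
proof -
  have "trace ((\<chi> k l. u $ k * u $ l / a) ** C) = (\<Sum>k\<in>UNIV. \<Sum>l\<in>UNIV. u $ k * u $ l / a * C $ l $ k)"
    by (simp add: trace_def matrix_matrix_mult_def)
  also have "\<dots> = (\<Sum>l\<in>UNIV. \<Sum>k\<in>UNIV. u $ k * u $ l / a * C $ l $ k)" by (rule sum.swap)
  also have "\<dots> = (u \<bullet> (C *v u)) / a"
    by (simp add: inner_vec_def matrix_vector_mult_def sum_distrib_left sum_divide_distrib mult_ac)
  finally show ?thesis .
qed

text \<open>
  Induction on the number of nonzero diagonal entries: subtracting from \<open>A\<close> the rank-one
  matrix \<open>v v\<^sup>T\<close> with \<open>v = A e\<^sub>i / sqrt (A\<^sub>i\<^sub>i)\<close> keeps it positive semidefinite by the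
  Cauchy-Schwarz inequality, annihilates the \<open>i\<close>-th diagonal entry, and lowers the trace by
  \<open>v\<^sup>T C v \<ge> 0\<close>. This replaces the spectral theorem.
\<close>
lemma trace_mult_pos_semidef:
  fixes A C :: "real^'n^'n"
  assumes "pos_semidef A" and C: "pos_semidef C"
  shows "0 \<le> trace (A ** C)"
  using assms(1)
proof (induction "card {i. A $ i $ i \<noteq> 0}" arbitrary: A rule: less_induct)
  case (less A)
  note A = less.prems
  show ?case
  proof (cases "\<exists>i. A $ i $ i \<noteq> 0")
    case False
    then have "A *v axis i 1 = 0" for i
      using pos_semidef_null[OF A, of "axis i 1"] diag_eq[of i A] by simp
    then have "A $ i $ j = 0" for i j
      by (simp add: matrix_vector_mult_basis column_def vec_eq_iff)
    then have "A = 0" by (simp add: vec_eq_iff)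
    then show ?thesis by (simp add: trace_def)
  next
    case True
    then obtain i where i: "A $ i $ i \<noteq> 0" by blast
    let ?a = "A $ i $ i" and ?u = "A *v axis i 1"
    have a: "?a > 0" using A i diag_eq[of i A] unfolding pos_semidef_def by (metis less_eq_real_def)
    define R :: "real^'n^'n" where "R = (\<chi> k l. ?u $ k * ?u $ l / ?a)"
    have R: "R *v x = ((?u \<bullet> x) / ?a) *\<^sub>R ?u" for x
      by (simp add: R_def vec_eq_iff matrix_vector_mult_def inner_vec_def sum_distrib_left
          sum_divide_distrib mult_ac)
    have sA: "sym_mat A" using A by (simp add: pos_semidef_def)
    have uk: "?u $ k = A $ k $ i" for k by (simp add: matrix_vector_mult_basis column_def)
    have sR: "transpose R = R" by (simp add: R_def transpose_def vec_eq_iff mult.commute)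
    have quad: "x \<bullet> ((A - R) *v x) = x \<bullet> (A *v x) - (?u \<bullet> x)\<^sup>2 / ?a" for x
      by (simp add: matrix_vector_mult_diff_rdistrib inner_diff_right R power2_eq_square inner_commute)
    have psd: "pos_semidef (A - R)"
      unfolding pos_semidef_def
    proof
      show "sym_mat (A - R)" using sA sR by (simp add: sym_mat_def transpose_def vec_eq_iff)
      show "\<forall>x. 0 \<le> x \<bullet> ((A - R) *v x)"
      proof
        fix x
        have "(?u \<bullet> x)\<^sup>2 \<le> (x \<bullet> (A *v x)) * ?a"
          using pos_semidef_Cauchy_Schwarz[OF A, of x "axis i 1"] by (simp add: diag_eq inner_commute)
        then show "0 \<le> x \<bullet> ((A - R) *v x)" using a by (simp add: quad divide_le_eq)
      qed
    qed
    have diag: "(A - R) $ k $ k = A $ k $ k - (A $ k $ i)\<^sup>2 / ?a" for k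
      by (simp add: R_def uk power2_eq_square)
    have zero: "A $ k $ i = 0" if "A $ k $ k = 0" for k
    proof -
      have "A *v axis k 1 = 0" using pos_semidef_null[OF A, of "axis k 1"] that diag_eq[of k A] by simp
      then have "A $ i $ k = 0" by (simp add: matrix_vector_mult_basis column_def vec_eq_iff)
      then show ?thesis using sA unfolding sym_mat_def transpose_def by (metis vec_lambda_beta)
    qed
    have "{k. (A - R) $ k $ k \<noteq> 0} \<subset> {k. A $ k $ k \<noteq> 0}"
    proof
      show "{k. (A - R) $ k $ k \<noteq> 0} \<subseteq> {k. A $ k $ k \<noteq> 0}" using diag zero by auto
      have "(A - R) $ i $ i = 0" using diag[of i] i by (simp add: power2_eq_square)
      then show "{k. (A - R) $ k $ k \<noteq> 0} \<noteq> {k. A $ k $ k \<noteq> 0}" using i by blast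
    qed
    then have "card {k. (A - R) $ k $ k \<noteq> 0} < card {k. A $ k $ k \<noteq> 0}"
      by (intro psubset_card_mono) auto
    then have IH: "0 \<le> trace ((A - R) ** C)" using less.hyps psd by blast
    have "trace (R ** C) = (?u \<bullet> (C *v ?u)) / ?a"
      unfolding R_def by (rule trace_rank_one_mult)
    then have "0 \<le> trace (R ** C)" using C a by (simp add: pos_semidef_def)
    moreover have "trace (A ** C) = trace ((A - R) ** C) + trace (R ** C)"
      by (simp add: matrix_mult_rdistrib_diff trace_sub)
    ultimately show ?thesis using IH by simp
  qed
qed

lemma quadratic_form_lower_bound:
  fixes A :: "real^'n^'n"
  assumes A: "\<And>x. x \<noteq> 0 \<Longrightarrow> 0 < x \<bullet> (A *v x)"
  obtains c where "c > 0" "\<And>x. c * (norm x)\<^sup>2 \<le> x \<bullet> (A *v x)"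
proof -
  let ?S = "sphere (0 :: real^'n) 1"
  have "?S \<noteq> {}" using vector_choose_size[of 1] by (auto simp: sphere_def dist_norm)
  moreover have "continuous_on ?S (\<lambda>x. x \<bullet> (A *v x))"
    by (intro continuous_intros linear_continuous_on matrix_vector_mul_bounded_linear)
  ultimately obtain y where y: "y \<in> ?S" "\<And>x. x \<in> ?S \<Longrightarrow> y \<bullet> (A *v y) \<le> x \<bullet> (A *v x)"
    using continuous_attains_inf[of ?S "\<lambda>x. x \<bullet> (A *v x)"] by auto
  show thesis
  proof (rule that)
    have "y \<noteq> 0" using y(1) by auto
    then show "0 < y \<bullet> (A *v y)" by (rule A)
    show "(y \<bullet> (A *v y)) * (norm x)\<^sup>2 \<le> x \<bullet> (A *v x)" for x
    proof (cases "x = 0")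
      case False
      have "y \<bullet> (A *v y) \<le> ((1 / norm x) *\<^sub>R x) \<bullet> (A *v ((1 / norm x) *\<^sub>R x))"
        by (rule y(2)) (use False in simp)
      then show ?thesis using False
        by (simp add: matrix_vector_mult_scaleR field_simps power2_eq_square)
    qed simp
  qed
qed

text \<open>
  As \<open>A \<ge> c I\<close> for some \<open>c > 0\<close>, the trace is at least \<open>c tr (Q\<^sup>T B Q)\<close>, which is the sum of
  the values of the quadratic form of \<open>B\<close> at the columns of \<open>Q\<close>.
\<close>

lemma trace_congruence_pos:
  fixes A B Q :: "real^'n^'n"
  assumes A: "pos_def A" and B: "pos_def B" and Q: "Q \<noteq> 0"
  shows "0 < trace (A ** (transpose Q ** B ** Q))"
proof -
  let ?C = "transpose Q ** B ** Q"
  have C: "pos_semidef ?C" by (intro pos_semidef_congruence pos_def_imp_semidef B)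
  obtain c where c: "c > 0" "\<And>x. c * (norm x)\<^sup>2 \<le> x \<bullet> (A *v x)"
    using quadratic_form_lower_bound[of A] A unfolding pos_def_def by blast
  have "pos_semidef (A - mat c)"
    unfolding pos_semidef_def
  proof
    show "sym_mat (A - mat c)"
      using A by (simp add: pos_def_def sym_mat_def transpose_def mat_def vec_eq_iff)
    show "\<forall>x. 0 \<le> x \<bullet> ((A - mat c) *v x)"
      using c(2) by (simp add: matrix_vector_mult_diff_rdistrib inner_diff_right power2_norm_eq_inner mat_vec_mult)
  qed
  then have "0 \<le> trace ((A - mat c) ** ?C)" using C by (rule trace_mult_pos_semidef)
  also have "mat c = c *\<^sub>R (mat 1 :: real^'n^'n)" by (rule mat_eq_scaleR)
  finally have 1: "c * trace ?C \<le> trace (A ** ?C)"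
    by (simp add: matrix_mult_rdistrib_diff trace_sub scalar_matrix_assoc[symmetric] trace_scaleR)
  have eq: "axis i 1 \<bullet> (?C *v axis i 1) = (Q *v axis i 1) \<bullet> (B *v (Q *v axis i 1))" for i
    by (metis dot_lmul_matrix inner_commute matrix_vector_mul_assoc transpose_matrix_vector)
  obtain i where i: "Q *v axis i 1 \<noteq> 0"
    using Q by (auto simp: matrix_vector_mult_basis column_def vec_eq_iff)
  have "0 < trace ?C"
    unfolding trace_eq_sum
  proof (rule sum_pos2[of _ i])
    show "0 < axis i 1 \<bullet> (?C *v axis i 1)" unfolding eq using B i by (simp add: pos_def_def)
    show "0 \<le> axis j 1 \<bullet> (?C *v axis j 1)" for j using C by (simp add: pos_semidef_def)
  qed auto
  then have "0 < c * trace ?C" using c(1) by simp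
  then show ?thesis using 1 by linarith
qed

lemma trace_congruence_nonneg:
  fixes A B Q :: "real^'n^'n"
  assumes "pos_def A" and "pos_def B"
  shows "0 \<le> trace (A ** (transpose Q ** B ** Q))"
  using assms by (intro trace_mult_pos_semidef pos_semidef_congruence pos_def_imp_semidef)

section \<open>Inverses and determinants\<close>

lemma matrix_inv_eqs:
  assumes "invertible (A :: real^'n^'n)"
  shows "A ** matrix_inv A = mat 1" "matrix_inv A ** A = mat 1"
  using someI_ex[OF assms[unfolded invertible_def], folded matrix_inv_def] by auto

lemma matrix_inv_unique:
  assumes "A ** B = mat 1" "B ** (A :: real^'n^'n) = mat 1"
  shows "matrix_inv A = B"
proof -
  have "invertible A" using assms unfolding invertible_def by blast
  then have "matrix_inv A ** (A ** B) = B" using matrix_inv_eqs(2)[of A] by (simp add: matrix_mul_assoc)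
  then show ?thesis using assms by simp
qed

lemma pos_def_invertible:
  assumes "pos_def (A :: real^'n^'n)"
  shows "invertible A"
proof -
  have "x = 0" if "A *v x = 0" for x using assms that unfolding pos_def_def by force
  then show ?thesis
    by (simp add: invertible_left_inverse matrix_left_invertible_ker)
qed

lemma sym_mat_inv:
  assumes "sym_mat A" "invertible (A :: real^'n^'n)"
  shows "sym_mat (matrix_inv A)"
proof -
  have "A ** transpose (matrix_inv A) = mat 1" "transpose (matrix_inv A) ** A = mat 1"
    using arg_cong[OF matrix_inv_eqs(2)[OF assms(2)], of transpose]
      arg_cong[OF matrix_inv_eqs(1)[OF assms(2)], of transpose] assms(1)
    by (simp_all add: matrix_transpose_mul sym_mat_def)
  then show ?thesis unfolding sym_mat_def using matrix_inv_unique by metis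
qed

lemma pos_def_inv:
  assumes A: "pos_def (A :: real^'n^'n)"
  shows "pos_def (matrix_inv A)"
  unfolding pos_def_def
proof (intro conjI allI impI)
  have inv: "invertible A" using A by (rule pos_def_invertible)
  show "sym_mat (matrix_inv A)" using A inv by (simp add: pos_def_def sym_mat_inv)
  fix x :: "real^'n" assume x: "x \<noteq> 0"
  let ?y = "matrix_inv A *v x"
  have Ay: "A *v ?y = x" using matrix_inv_eqs[OF inv] by (simp add: matrix_vector_mul_assoc)
  then have "?y \<noteq> 0" using x by auto
  then have "0 < ?y \<bullet> (A *v ?y)" using A by (simp add: pos_def_def)
  then show "0 < x \<bullet> ?y" by (simp add: Ay inner_commute)
qed

lemma matrix_inv_diff:
  assumes "invertible (A :: real^'n^'n)" "invertible B"
  shows "matrix_inv B - matrix_inv A = - (matrix_inv B ** (B - A) ** matrix_inv A)"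
  using matrix_inv_eqs[OF assms(1)] matrix_inv_eqs[OF assms(2)]
  by (simp add: matrix_mult_ldistrib_diff matrix_mult_rdistrib_diff flip: matrix_mul_assoc)

lemma continuous_on_det [continuous_intros]:
  fixes A :: "'a::topological_space \<Rightarrow> real^'n^'n"
  assumes "continuous_on S A"
  shows "continuous_on S (\<lambda>x. det (A x))"
  unfolding det_def by (intro continuous_intros assms)

text \<open>Cramer's rule expresses the entries of the inverse by determinants.\<close>

lemma continuous_on_matrix_inv:
  fixes A :: "'a::topological_space \<Rightarrow> real^'n^'n"
  assumes cont: "continuous_on S A" and inv: "\<And>x. x \<in> S \<Longrightarrow> invertible (A x)"
  shows "continuous_on S (\<lambda>x. matrix_inv (A x))"
proof -
  let ?M = "\<lambda>x k j. (\<chi> i l. if l = k then axis j 1 $ i else A x $ i $ l) :: real^'n^'n"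
  have entry: "matrix_inv (A x) $ k $ j = det (?M x k j) / det (A x)" if x: "x \<in> S" for x k j
  proof -
    have "A x *v (matrix_inv (A x) *v axis j 1) = axis j 1"
      using matrix_inv_eqs[OF inv[OF x]] by (simp add: matrix_vector_mul_assoc)
    then have "matrix_inv (A x) *v axis j 1 = (\<chi> k. det (?M x k j) / det (A x))"
      using cramer[of "A x" "matrix_inv (A x) *v axis j 1" "axis j 1"] inv[OF x] invertible_det_nz[of "A x"] by auto
    then show ?thesis by (simp add: matrix_vector_mult_basis column_def vec_eq_iff)
  qed
  have "continuous_on S (\<lambda>x. det (?M x k j) / det (A x))" for k j
  proof (intro continuous_intros cont)
    show "continuous_on S (\<lambda>x. if l = k then axis j 1 $ i else A x $ i $ l)" for i l
      by (cases "l = k") (auto intro!: continuous_intros cont)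
    show "\<forall>x\<in>S. det (A x) \<noteq> 0" using inv invertible_det_nz by blast
  qed
  then have "continuous_on S (\<lambda>x. (\<chi> k j. det (?M x k j) / det (A x)) :: real^'n^'n)"
    by (intro continuous_on_vec_lambda)
  then show ?thesis
    by (rule continuous_on_eq) (simp add: entry vec_eq_iff)
qed

text \<open>
  Applying \<open>B\<^sup>-\<^sup>1 - A\<^sup>-\<^sup>1 = - B\<^sup>-\<^sup>1 (B - A) A\<^sup>-\<^sup>1\<close> twice gives the exact remainder
  \<open>M y ** h d ** M x ** h d ** M x\<close>, where \<open>M\<close> is the inverse; continuity makes it bounded on
  compact sets.
\<close>

lemma quad_approx_matrix_inv:
  fixes h :: "'a::euclidean_space \<Rightarrow> real^'n^'n"
  assumes h: "bounded_linear h" and C: "compact C" and inv: "\<And>x. x \<in> C \<Longrightarrow> invertible (h x)"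
  shows "quad_approx C (\<lambda>x. matrix_inv (h x)) (\<lambda>x d. - (matrix_inv (h x) ** h d ** matrix_inv (h x)))"
proof -
  interpret B: bounded_bilinear "(**) :: real^'n^'n \<Rightarrow> real^'n^'n \<Rightarrow> real^'n^'n"
    by (rule bounded_bilinear_matrix_mult)
  obtain P where P: "P \<ge> 0" "\<And>(a :: real^'n^'n) (b :: real^'n^'n). norm (a ** b) \<le> norm a * norm b * P"
    using B.nonneg_bounded by auto
  obtain K where K: "K \<ge> 0" "\<And>x. norm (h x) \<le> norm x * K"
    using bounded_linear.nonneg_bounded[OF h] by blast
  have "continuous_on C (\<lambda>x. matrix_inv (h x))"
    using h by (intro continuous_on_matrix_inv inv linear_continuous_on)
  then have "bounded ((\<lambda>x. matrix_inv (h x)) ` C)"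
    using C compact_continuous_image compact_imp_bounded by blast
  then obtain N where N: "N > 0" "\<And>x. x \<in> C \<Longrightarrow> norm (matrix_inv (h x)) \<le> N"
    unfolding bounded_pos by blast
  have mul: "norm (a ** b) \<le> r * s * P" if "norm a \<le> r" "norm b \<le> s" for a b :: "real^'n^'n" and r s
  proof -
    have "norm a * norm b \<le> r * s"
      by (rule mult_mono[OF that]) (use that norm_ge_zero order_trans in blast)+
    then show ?thesis using P(2)[of a b] mult_right_mono[OF _ P(1)] order_trans by blast
  qed
  define c1 where "c1 = N * K * P * N * P"
  define c2 where "c2 = N * K * P * N * P * K * P * N * P"
  have c: "c1 \<ge> 0" "c2 \<ge> 0" using N K P by (auto simp: c1_def c2_def)
  show ?thesis
  proof (rule quad_approxI[of "N + c1 + c2"])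
    fix x d assume x: "x \<in> C"
    show "norm (matrix_inv (h x)) \<le> N + c1 + c2" using N(2)[OF x] c by simp
    have "norm (matrix_inv (h x) ** h d ** matrix_inv (h x)) \<le> N * (norm d * K) * P * N * P"
      by (intro mul N(2)[OF x] K(2))
    also have "\<dots> = c1 * norm d" by (simp add: c1_def)
    also have "\<dots> \<le> (N + c1 + c2) * norm d" using N(1) c by (intro mult_right_mono) auto
    finally show "norm (- (matrix_inv (h x) ** h d ** matrix_inv (h x))) \<le> (N + c1 + c2) * norm d" by simp
  next
    fix x y assume xy: "x \<in> C" "y \<in> C"
    let ?M = "\<lambda>x. matrix_inv (h x)"
    define d where "d = y - x"
    have hd: "h y - h x = h d" by (simp add: d_def linear_diff bounded_linear.linear[OF h])
    have diff: "?M y - ?M x = - (?M y ** h d ** ?M x)"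
      using matrix_inv_diff[OF inv[OF xy(1)] inv[OF xy(2)]] by (simp add: hd)
    have "?M y - ?M x - - (?M x ** h d ** ?M x) = - (?M y ** h d ** ?M x) - - (?M x ** h d ** ?M x)"
      by (simp only: diff)
    also have "\<dots> = - ((?M y - ?M x) ** h d ** ?M x)"
      by (simp only: matrix_mult_rdistrib_diff) simp
    also have "\<dots> = ?M y ** h d ** ?M x ** h d ** ?M x"
      by (simp add: diff B.minus_left)
    also have "norm \<dots> \<le> N * (norm d * K) * P * N * P * (norm d * K) * P * N * P"
      by (intro mul N(2)[OF xy(1)] N(2)[OF xy(2)] K(2))
    also have "\<dots> = c2 * (norm d)\<^sup>2" by (simp add: c2_def power2_eq_square)
    also have "\<dots> \<le> (N + c1 + c2) * (norm d)\<^sup>2" using N(1) c by (intro mult_right_mono) auto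
    finally show "norm (?M y - ?M x - - (?M x ** h (y - x) ** ?M x)) \<le> (N + c1 + c2) * (norm (y - x))\<^sup>2"
      by (simp add: d_def)
  qed (use N c in auto)
qed

text \<open>At the identity only the identity permutation contributes to the first-order change of
  the determinant: any other one has at least two factors off the diagonal.\<close>

lemma det_derivative_mat_1:
  "((\<lambda>t. det (mat 1 + t *\<^sub>R A :: real^'n^'n)) has_real_derivative trace A) (at 0)"
proof -
  have mat1: "(mat 1 :: real^'n^'n) $ i $ j = (if i = j then 1 else 0)" for i j by (simp add: mat_def)
  let ?D = "\<lambda>p. \<Sum>i\<in>UNIV. A $ i $ p i * (\<Prod>j\<in>UNIV - {i}. (mat 1 :: real^'n^'n) $ j $ p j)"
  let ?P = "{p. p permutes (UNIV :: 'n set)}"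
  have "((\<lambda>t. \<Prod>i\<in>UNIV. mat 1 $ i $ p i + t * A $ i $ p i) has_real_derivative ?D p) (at 0)" for p
  proof -
    have fac: "((\<lambda>t. (mat 1 :: real^'n^'n) $ i $ p i + t * A $ i $ p i) has_derivative (\<lambda>t. t * A $ i $ p i)) (at 0)" for i
      by (auto intro!: derivative_eq_intros)
    have "((\<lambda>t. \<Prod>i\<in>UNIV. (mat 1 :: real^'n^'n) $ i $ p i + t * A $ i $ p i) has_derivative
        (\<lambda>t. \<Sum>i\<in>UNIV. t * A $ i $ p i * (\<Prod>j\<in>UNIV - {i}. (mat 1 :: real^'n^'n) $ j $ p j + 0 * A $ j $ p j))) (at 0)"
      by (rule has_derivative_prod) (rule fac)
    also have "(\<lambda>t. \<Sum>i\<in>UNIV. t * A $ i $ p i * (\<Prod>j\<in>UNIV - {i}. (mat 1 :: real^'n^'n) $ j $ p j + 0 * A $ j $ p j))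
        = (*) (?D p)"
      by (rule ext) (simp add: sum_distrib_left mult_ac)
    finally show ?thesis
      unfolding has_field_derivative_def .
  qed
  then have "((\<lambda>t. det (mat 1 + t *\<^sub>R A)) has_real_derivative (\<Sum>p\<in>?P. of_int (sign p) * ?D p)) (at 0)"
    unfolding det_def by (auto intro!: DERIV_sum DERIV_cmult)
  also have "(\<Sum>p\<in>?P. of_int (sign p) * ?D p) = (\<Sum>p\<in>{id}. of_int (sign p) * ?D p)"
  proof (rule sum.mono_neutral_right)
    show "finite ?P" by (simp add: finite_permutations)
    show "{id} \<subseteq> ?P" by (simp add: permutes_id)
    show "\<forall>p\<in>?P - {id}. of_int (sign p) * ?D p = 0"
    proof
      fix p assume p: "p \<in> ?P - {id}"
      then have "inj p" by (auto intro: permutes_inj)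
      obtain k where k: "p k \<noteq> k" using p by (auto simp: fun_eq_iff)
      have zero: "(\<Prod>j\<in>UNIV - {i}. (mat 1 :: real^'n^'n) $ j $ p j) = 0" for i
      proof -
        have "\<exists>j. j \<noteq> i \<and> p j \<noteq> j" using k \<open>inj p\<close> by (metis injD)
        then obtain j where "j \<in> UNIV - {i}" "(mat 1 :: real^'n^'n) $ j $ p j = 0"
          by (auto simp: mat1)
        then show ?thesis by (meson finite prod_zero finite_Diff)
      qed
      show "of_int (sign p) * ?D p = 0" unfolding zero by simp
    qed
  qed
  also have "\<dots> = trace A" by (simp add: sign_id mat1 trace_def)
  finally show ?thesis .
qed

text \<open>
  Translate to the identity by factoring out \<open>X\<close>.
\<close>

lemma det_derivative:
  assumes "invertible (X :: real^'n^'n)"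
  shows "((\<lambda>t. det (X + t *\<^sub>R D)) has_real_derivative det X * trace (matrix_inv X ** D)) (at 0)"
proof -
  have "X + t *\<^sub>R D = X ** (mat 1 + t *\<^sub>R (matrix_inv X ** D))" for t
    using matrix_inv_eqs[OF assms]
    by (simp add: matrix_add_ldistrib matrix_scalar_ac matrix_mul_assoc flip: scalar_matrix_assoc)
  then show ?thesis
    by (auto simp: det_mul intro!: DERIV_cmult det_derivative_mat_1)
qed

lemma pos_def_mat: "c > 0 \<Longrightarrow> pos_def (mat c :: real^'n^'n)"
proof -
  assume c: "c > 0"
  then show ?thesis by (simp add: pos_def_def sym_mat_def mat_vec_mult)
qed

lemma pos_def_comb:
  assumes A: "pos_def A" and B: "pos_def B" and "0 \<le> s" "0 \<le> t" "s + t = 1"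
  shows "pos_def (s *\<^sub>R A + t *\<^sub>R B)"
  unfolding pos_def_def
proof (intro conjI allI impI)
  show "sym_mat (s *\<^sub>R A + t *\<^sub>R B)"
    using A B by (simp add: pos_def_def sym_mat_def transpose_def vec_eq_iff)
  fix x :: "real^'a" assume "x \<noteq> 0"
  then have ab: "0 < x \<bullet> (A *v x)" "0 < x \<bullet> (B *v x)" using A B by (auto simp: pos_def_def)
  have eq: "x \<bullet> ((s *\<^sub>R A + t *\<^sub>R B) *v x) = s * (x \<bullet> (A *v x)) + t * (x \<bullet> (B *v x))"
    by (simp add: matrix_vector_mult_add_rdistrib scaleR_matrix_vector_assoc[symmetric] inner_add_right)
  show "0 < x \<bullet> ((s *\<^sub>R A + t *\<^sub>R B) *v x)"
  proof (cases "s = 0")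
    case True then show ?thesis using eq ab assms by simp
  next
    case False
    then show ?thesis unfolding eq using ab assms by (intro add_pos_nonneg) auto
  qed
qed

text \<open>
  Along the segment from the identity to \<open>X\<close> the determinant does not vanish, hence keeps
  its sign.
\<close>

lemma pos_def_det:
  assumes X: "pos_def (X :: real^'n^'n)"
  shows "0 < det X"
proof (rule ccontr)
  let ?h = "\<lambda>t::real. det ((1 - t) *\<^sub>R mat 1 + t *\<^sub>R X)"
  assume "\<not> 0 < det X"
  then have "?h 1 \<le> 0" by simp
  moreover have "0 \<le> ?h 0" by simp
  moreover have "continuous_on {0..1} ?h" by (intro continuous_intros)
  ultimately obtain t where t: "0 \<le> t" "t \<le> 1" "?h t = 0"
    using IVT2'[of ?h 1 0 0] by auto
  have "pos_def ((1 - t) *\<^sub>R mat 1 + t *\<^sub>R X)"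
    using t by (intro pos_def_comb pos_def_mat X) auto
  then show False using t pos_def_invertible invertible_det_nz by blast
qed

lemma log_det_derivative:
  assumes "pos_def (X :: real^'n^'n)"
  shows "((\<lambda>t. ln (det (X + t *\<^sub>R D))) has_real_derivative trace (matrix_inv X ** D)) (at 0)"
proof -
  have "det X > 0" using assms by (rule pos_def_det)
  then show ?thesis
    by (auto intro!: derivative_eq_intros det_derivative pos_def_invertible assms)
qed

text \<open>
  The slope of \<open>log det\<close> along the segment from \<open>B\<close> to \<open>X\<close> is nonincreasing: at parameter \<open>t\<close> it
  differs from the slope at \<open>B\<close> by \<open>- t tr (Y\<^sup>-\<^sup>1 D B\<^sup>-\<^sup>1 D) \<le> 0\<close>, where \<open>D = X - B\<close> and
  \<open>Y = B + t D\<close>.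
\<close>

lemma log_det_le_tangent:
  assumes X: "pos_def (X :: real^'n^'n)" and B: "pos_def B"
  shows "ln (det X) \<le> ln (det B) + trace (matrix_inv B ** (X - B))"
proof -
  let ?D = "X - B"
  let ?Y = "\<lambda>t. B + t *\<^sub>R ?D"
  have Y: "pos_def (?Y t)" if "0 \<le> t" "t \<le> 1" for t
  proof -
    have "?Y t = (1 - t) *\<^sub>R B + t *\<^sub>R X" by (simp add: algebra_simps)
    then show ?thesis using that by (simp add: pos_def_comb X B)
  qed
  have der: "DERIV (\<lambda>t. ln (det (?Y t))) t :> trace (matrix_inv (?Y t) ** ?D)" if "0 \<le> t" "t \<le> 1" for t
  proof -
    have eq: "?Y t + s *\<^sub>R ?D = ?Y (t + s)" for s by (simp add: algebra_simps)
    have "((\<lambda>s. ln (det (?Y (t + s)))) has_real_derivative trace (matrix_inv (?Y t) ** ?D)) (at 0)"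
      using log_det_derivative[OF Y[OF that], of ?D] unfolding eq .
    then show ?thesis using DERIV_shift[of "\<lambda>s. ln (det (?Y s))" _ 0 t] by (simp add: add.commute)
  qed
  obtain t where t: "0 < t" "t < 1"
    "ln (det (?Y 1)) - ln (det (?Y 0)) = (1 - 0) * trace (matrix_inv (?Y t) ** ?D)"
    using MVT2[of 0 1 "\<lambda>t. ln (det (?Y t))" "\<lambda>t. trace (matrix_inv (?Y t) ** ?D)"] der by auto
  have pd: "pos_def (?Y t)" using t by (intro Y) auto
  have sD: "transpose ?D = ?D"
    using X B by (simp add: pos_def_def sym_mat_def transpose_def vec_eq_iff)
  have "matrix_inv (?Y t) - matrix_inv B = - (matrix_inv (?Y t) ** (t *\<^sub>R ?D) ** matrix_inv B)"
    using matrix_inv_diff[OF pos_def_invertible[OF B] pos_def_invertible[OF pd]] by simp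
  then have "trace (matrix_inv (?Y t) ** ?D) - trace (matrix_inv B ** ?D)
      = - (t * trace (matrix_inv (?Y t) ** (transpose ?D ** matrix_inv B ** ?D)))"
    unfolding trace_sub[symmetric] matrix_mult_rdistrib_diff[symmetric] sD
    by (simp add: matrix_scalar_ac trace_scaleR trace_minus matrix_mul_assoc
        bounded_bilinear.minus_left[OF bounded_bilinear_matrix_mult] flip: scalar_matrix_assoc)
  also have "\<dots> \<le> 0"
    using trace_congruence_nonneg[OF pos_def_inv[OF pd] pos_def_inv[OF B], of ?D] t by simp
  finally show ?thesis using t(3) by simp
qed

section \<open>Gradient and second derivative of the objective\<close>

text \<open>
  Being linear, \<open>slack\<close> also describes the effect \<open>W = \<delta> I - D\<close> of a displacement \<open>(D, \<delta>)\<close>.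
\<close>

definition slack :: "(real^'p^'p) \<times> real \<Rightarrow> real^'p^'p" where
  "slack z = mat (snd z) - fst z"

lemma bounded_linear_slack: "bounded_linear (slack :: (real^'p::finite^'p) \<times> real \<Rightarrow> _)"
  unfolding linear_conv_bounded_linear[symmetric]
  by (rule linearI) (auto simp: slack_def mat_def vec_eq_iff algebra_simps)

lemmas linear_slack = bounded_linear.linear[OF bounded_linear_slack]
lemmas slack_add = linear_add[OF linear_slack]
lemmas slack_scaleR = linear_cmul[OF linear_slack]

definition resolvent :: "(real^'p^'p) \<times> real \<Rightarrow> real^'p^'p" where
  "resolvent z = matrix_inv (slack z)"

text \<open>
  The gradient of the objective as an element of the product space, in terms of \<open>resolvent\<close>;
  \<open>hess_op\<close> is its derivative.
\<close>

definition grad_op :: "real^'p^'p \<Rightarrow> real \<Rightarrow> (real^'p^'p) \<times> real \<Rightarrow> (real^'p^'p) \<times> real" where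
  "grad_op S \<rho> z = (let M = resolvent z; \<gamma> = snd z in
     (\<gamma>\<^sup>2 *\<^sub>R (M ** S ** M) - matrix_inv (fst z),
      \<rho>\<^sup>2 - trace S + 2 * \<gamma> * trace (M ** S) - \<gamma>\<^sup>2 * trace (M ** M ** S)))"

definition hess_op :: "real^'p^'p \<Rightarrow> (real^'p^'p) \<times> real \<Rightarrow> (real^'p^'p) \<times> real \<Rightarrow> (real^'p^'p) \<times> real" where
  "hess_op S z d = (let M = resolvent z; \<gamma> = snd z; Xi = matrix_inv (fst z); W = slack d; \<delta> = snd d in
     ((2 * \<gamma> * \<delta>) *\<^sub>R (M ** S ** M) - \<gamma>\<^sup>2 *\<^sub>R (M ** W ** M ** S ** M + M ** S ** M ** W ** M)
        + Xi ** fst d ** Xi,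
      2 * \<delta> * trace (M ** S) - 2 * \<gamma> * trace (M ** W ** M ** S) - 2 * \<gamma> * \<delta> * trace (M ** M ** S)
        + \<gamma>\<^sup>2 * trace (M ** W ** M ** M ** S + M ** M ** W ** M ** S)))"

definition sym_sparse :: "('p \<times> 'p) set \<Rightarrow> ((real^'p^'p) \<times> real) set" where
  "sym_sparse E = {d. sym_mat (fst d) \<and> (\<forall>(i, j)\<in>E. fst d $ i $ j = 0)}"

text \<open>
  The feasible set, as a subset of the subspace \<open>sym_sparse E\<close>.
\<close>

definition interior_cone :: "('p::finite \<times> 'p) set \<Rightarrow> ((real^'p^'p) \<times> real) set" where
  "interior_cone E = {z \<in> sym_sparse E. pos_def (fst z) \<and> pos_def (slack z)}"

lemma feasible_iff: "feasible E z \<longleftrightarrow> z \<in> interior_cone E"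
  by (cases z) (auto simp: feasible_def interior_cone_def sym_sparse_def loewner_greater_def
      sparsity_cone_def slack_def pos_def_def)

lemma interior_coneD:
  assumes "z \<in> interior_cone E"
  shows "pos_def (fst z)" "pos_def (slack z)" "pos_def (resolvent z)" "0 < snd z"
    "invertible (fst z)" "invertible (slack z)" "transpose (resolvent z) = resolvent z"
    "transpose (fst z) = fst z" "transpose (matrix_inv (fst z)) = matrix_inv (fst z)"
proof -
  show 1: "pos_def (fst z)" "pos_def (slack z)" using assms by (auto simp: interior_cone_def)
  then show 2: "pos_def (resolvent z)" "invertible (fst z)" "invertible (slack z)"
    by (auto simp: resolvent_def intro: pos_def_inv pos_def_invertible)
  show "transpose (resolvent z) = resolvent z" "transpose (fst z) = fst z"
    using 1 2 by (auto simp: pos_def_def sym_mat_def)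
  show "transpose (matrix_inv (fst z)) = matrix_inv (fst z)"
    using pos_def_inv[OF 1(1)] by (auto simp: pos_def_def sym_mat_def)
  let ?e = "axis undefined 1 :: real^'a"
  have "?e \<noteq> 0" by (simp add: axis_eq_0_iff)
  then have "0 < ?e \<bullet> (fst z *v ?e) + ?e \<bullet> (slack z *v ?e)"
    using 1 by (auto simp: pos_def_def intro: add_pos_pos)
  also have "\<dots> = snd z * (?e \<bullet> ?e)"
    by (simp add: slack_def matrix_vector_mult_diff_rdistrib inner_diff_right mat_vec_mult)
  finally show "0 < snd z" by (simp add: zero_less_mult_iff)
qed

lemma continuous_on_matrix_mult:
  fixes A :: "'a::topological_space \<Rightarrow> real^'n^'m" and B :: "'a \<Rightarrow> real^'k^'n"
  shows "continuous_on T A \<Longrightarrow> continuous_on T B \<Longrightarrow> continuous_on T (\<lambda>x. A x ** B x)"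
  by (rule bounded_bilinear.continuous_on[OF bounded_bilinear_matrix_mult])

lemma bounded_linear_trace: "bounded_linear (trace :: real^'n^'n \<Rightarrow> real)"
  using linear_trace by (simp add: linear_conv_bounded_linear)

lemmas continuous_on_trace = bounded_linear.continuous_on[OF bounded_linear_trace]
lemmas continuous_on_slack = bounded_linear.continuous_on[OF bounded_linear_slack]

context
  fixes C :: "((real^'p::finite^'p) \<times> real) set" and E
  assumes C: "compact C" "C \<subseteq> interior_cone E"
begin

lemma quad_approx_resolvent:
  "quad_approx C resolvent (\<lambda>z d. - (resolvent z ** slack d ** resolvent z))"
  unfolding resolvent_def
  by (rule quad_approx_matrix_inv[OF bounded_linear_slack C(1)]) (use C(2) interior_coneD in blast)

lemma quad_approx_inverse_fst:
  "quad_approx C (\<lambda>z. matrix_inv (fst z)) (\<lambda>z d. - (matrix_inv (fst z) ** fst d ** matrix_inv (fst z)))"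
  by (rule quad_approx_matrix_inv[OF bounded_linear_fst C(1)]) (use C(2) interior_coneD in blast)

lemma quad_approx_snd: "quad_approx C snd (\<lambda>z d. snd d)"
  using quad_approx_bounded_linear[OF bounded_linear_snd compact_imp_bounded[OF C(1)]] .

lemmas quad_approx_matrix_mult = quad_approx_bilinear[OF bounded_bilinear_matrix_mult]
lemmas quad_approx_snd_square = quad_approx_bilinear[OF bounded_bilinear_mult quad_approx_snd quad_approx_snd]
lemmas quad_approx_trace = quad_approx_compose[OF bounded_linear_trace]
lemmas quad_approx_resolvent_S = quad_approx_matrix_mult[OF quad_approx_resolvent quad_approx_const]

lemma quad_approx_grad_op: "quad_approx C (grad_op S \<rho>) (hess_op S)"
proof -
  note MSM = quad_approx_matrix_mult[OF quad_approx_resolvent_S[of S] quad_approx_resolvent]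
  note MMS = quad_approx_matrix_mult[OF quad_approx_matrix_mult[OF quad_approx_resolvent quad_approx_resolvent]
      quad_approx_const[of C S]]
  note X = quad_approx_diff[OF quad_approx_bilinear[OF bounded_bilinear_scaleR quad_approx_snd_square MSM]
      quad_approx_inverse_fst]
  note a = quad_approx_bilinear[OF bounded_bilinear_mult quad_approx_compose[OF bounded_linear_mult_right[of 2] quad_approx_snd]
      quad_approx_trace[OF quad_approx_resolvent_S[of S]]]
  note b = quad_approx_bilinear[OF bounded_bilinear_mult quad_approx_snd_square quad_approx_trace[OF MMS]]
  note c = quad_approx_diff[OF quad_approx_add[OF quad_approx_const[of C "\<rho>\<^sup>2 - trace S"] a] b]
  have dbl: "(2 * (a * b)) *\<^sub>R Z = (b * a) *\<^sub>R Z + (a * b) *\<^sub>R Z"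
    "(2 * a * b) *\<^sub>R Z = (b * a) *\<^sub>R Z + (a * b) *\<^sub>R Z" for a b :: real and Z :: "real^'p^'p"
    by (simp_all add: mult.commute flip: scaleR_add_left)
  have 1: "quad_approx C (\<lambda>z. fst (grad_op S \<rho> z)) (\<lambda>z d. fst (hess_op S z d))"
    by (rule quad_approx_cong[OF X])
      (simp_all add: grad_op_def hess_op_def Let_def power2_eq_square dbl scaleR_add_left matrix_expand)
  have 2: "quad_approx C (\<lambda>z. snd (grad_op S \<rho> z)) (\<lambda>z d. snd (hess_op S z d))"
    by (rule quad_approx_cong[OF c])
      (simp_all add: grad_op_def hess_op_def Let_def power2_eq_square matrix_expand trace_expand algebra_simps)
  show ?thesis using quad_approx_Pair[OF 1 2] by simp
qed

text \<open>
  The part of the objective besides \<open>- log det X\<close>.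
\<close>

lemma quad_approx_transport:
  "quad_approx C (\<lambda>z. snd z * (\<rho>\<^sup>2 - trace S) + (snd z)\<^sup>2 * trace (resolvent z ** S))
     (\<lambda>z d. snd d * (\<rho>\<^sup>2 - trace S) + 2 * snd z * snd d * trace (resolvent z ** S)
        - (snd z)\<^sup>2 * trace (resolvent z ** slack d ** resolvent z ** S))"
proof -
  note a = quad_approx_compose[OF bounded_linear_mult_left[of "\<rho>\<^sup>2 - trace S"] quad_approx_snd]
  note b = quad_approx_bilinear[OF bounded_bilinear_mult quad_approx_snd_square
      quad_approx_trace[OF quad_approx_resolvent_S[of S]]]
  show ?thesis
    by (rule quad_approx_cong[OF quad_approx_add[OF a b]])
      (simp_all add: power2_eq_square matrix_expand trace_expand algebra_simps)
qed

end

lemma linear_hess_op: "linear (hess_op S z)"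
proof (rule linearI)
  fix d e
  have dist: "(a * (b + c)) *\<^sub>R Z = (a * b) *\<^sub>R Z + (a * c) *\<^sub>R Z" for a b c and Z :: "real^'a^'a"
    by (simp add: distrib_left scaleR_add_left)
  show "hess_op S z (d + e) = hess_op S z d + hess_op S z e"
    by (rule prod_eqI)
      (simp_all add: hess_op_def Let_def slack_add matrix_expand trace_expand distrib_left distrib_right dist scaleR_add_left)
next
  fix c d
  show "hess_op S z (c *\<^sub>R d) = c *\<^sub>R hess_op S z d"
    by (rule prod_eqI)
      (simp_all add: hess_op_def Let_def slack_scaleR matrix_expand trace_expand distrib_left right_diff_distrib mult_ac)
qed

lemma continuous_on_hess_op:
  assumes C: "C \<subseteq> interior_cone E"
  shows "continuous_on (C \<times> UNIV) (\<lambda>(z, d). hess_op S z d \<bullet> d)"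
proof -
  have fs: "continuous_on (C \<times> UNIV) (\<lambda>x. fst (fst x))" "continuous_on (C \<times> UNIV) (\<lambda>x. snd (fst x))"
    "continuous_on (C \<times> UNIV) (\<lambda>x. fst (snd x))" "continuous_on (C \<times> UNIV) (\<lambda>x. snd (snd x))"
    "continuous_on (C \<times> UNIV) (\<lambda>x. snd x)"
    by (intro continuous_intros)+
  have W: "continuous_on (C \<times> UNIV) (\<lambda>x. slack (snd x))"
    by (rule continuous_on_slack[OF fs(5)])
  have M: "continuous_on (C \<times> UNIV) (\<lambda>x. resolvent (fst x))"
    unfolding resolvent_def
    by (rule continuous_on_matrix_inv[OF continuous_on_slack[OF continuous_on_fst[OF continuous_on_id]]])
      (use C in \<open>auto intro!: interior_coneD(6)[of _ E]\<close>)
  have X: "continuous_on (C \<times> UNIV) (\<lambda>x. matrix_inv (fst (fst x)))"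
    by (rule continuous_on_matrix_inv[OF fs(1)]) (use C in \<open>auto intro!: interior_coneD(5)[of _ E]\<close>)
  show ?thesis
    unfolding hess_op_def Let_def case_prod_beta
    by (intro fs W M X continuous_on_matrix_mult continuous_on_add continuous_on_diff continuous_on_scaleR
        continuous_on_mult continuous_on_trace continuous_on_inner continuous_on_Pair continuous_on_const
        continuous_on_power)
qed

text \<open>
  Both sides are linear combinations of traces of words that contain \<open>S\<close> once. Rotating each
  word cyclically until it starts with \<open>S\<close> makes them equal term by term.
\<close>

lemma transport_curvature_identity:
  fixes M S W :: "real^'n^'n"
  assumes sym: "transpose M = M" "transpose S = S" "transpose W = W"
  shows "((2 * \<gamma> * \<delta>) *\<^sub>R (M ** S ** M) - \<gamma>\<^sup>2 *\<^sub>R (M ** W ** M ** S ** M + M ** S ** M ** W ** M))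
        \<bullet> (mat \<delta> - W)
      + (2 * \<delta> * trace (M ** S) - 2 * \<gamma> * trace (M ** W ** M ** S) - 2 * \<gamma> * \<delta> * trace (M ** M ** S)
        + \<gamma>\<^sup>2 * trace (M ** W ** M ** M ** S + M ** M ** W ** M ** S)) * \<delta>
    = 2 * trace (S ** (transpose (mat \<delta> - \<gamma> *\<^sub>R (W ** M)) ** M ** (mat \<delta> - \<gamma> *\<^sub>R (W ** M))))"
proof -
  have rot: "trace (M ** B) = trace (B ** M)" "trace (W ** B) = trace (B ** W)" for B
    by (rule trace_mul_sym)+
  show ?thesis
    unfolding mat_eq_scaleR[of \<delta>]
    by (simp only: inner_eq_trace transpose_expand sym, simp only: matrix_expand trace_expand, simp only: rot matrix_mul_assoc[symmetric], simp add: algebra_simps power2_eq_square)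
qed

text \<open>
  The second derivative is the sum of the curvatures of \<open>- log det\<close> and of the resolvent
  term. The first vanishes only for \<open>D = 0\<close>. In that case \<open>\<delta> \<noteq> 0\<close>, and \<open>Q = \<delta> (I - \<gamma> M)\<close> being
  zero would mean \<open>\<gamma> I - X = \<gamma> I\<close>, that is \<open>X = 0\<close>.
\<close>

lemma hess_op_pos:
  assumes S: "pos_def S" and z: "z \<in> interior_cone E" and d: "sym_mat (fst d)" "d \<noteq> 0"
  shows "0 < hess_op S z d \<bullet> d"
proof -
  let ?M = "resolvent z" and ?X = "matrix_inv (fst z)" and ?W = "slack d" and ?D = "fst d"
  define Q where "Q = mat (snd d) - snd z *\<^sub>R (?W ** ?M)"
  note zD = interior_coneD[OF z]
  have D: "transpose ?D = ?D" using d by (simp add: sym_mat_def)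
  have W: "transpose ?W = ?W" by (simp add: slack_def transpose_expand D)
  have DW: "?D = mat (snd d) - ?W" by (simp add: slack_def)
  have XX: "(?X ** ?D ** ?X) \<bullet> ?D = trace (?X ** (transpose ?D ** ?X ** ?D))"
    by (simp add: inner_eq_trace transpose_expand zD D matrix_mul_assoc)
  have "hess_op S z d \<bullet> d = trace (?X ** (transpose ?D ** ?X ** ?D)) + 2 * trace (S ** (transpose Q ** ?M ** Q))"
    unfolding Q_def XX[symmetric]
    unfolding transport_curvature_identity[symmetric, OF zD(7) S[unfolded pos_def_def sym_mat_def, THEN conjunct1] W]
    by (simp add: hess_op_def Let_def inner_prod_def inner_add_left DW[symmetric])
  moreover have "0 \<le> trace (S ** (transpose Q ** ?M ** Q))"
    by (rule trace_congruence_nonneg[OF S zD(3)])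
  moreover have "0 \<le> trace (?X ** (transpose ?D ** ?X ** ?D))"
    by (intro trace_congruence_nonneg pos_def_inv zD)
  moreover have "0 < trace (?X ** (transpose ?D ** ?X ** ?D))" if "?D \<noteq> 0"
    by (intro trace_congruence_pos pos_def_inv zD that)
  moreover have "0 < trace (S ** (transpose Q ** ?M ** Q))" if "?D = 0"
  proof (rule trace_congruence_pos[OF S zD(3)])
    have \<delta>: "snd d \<noteq> 0" using that d(2) by (metis prod.collapse zero_prod_def)
    show "Q \<noteq> 0"
    proof
      assume "Q = 0"
      then have "Q ** slack z = 0" by simp
      then have "snd d *\<^sub>R slack z = (snd z * snd d) *\<^sub>R mat 1"
        using matrix_inv_eqs(2)[OF zD(6)] that
        by (simp add: Q_def slack_def[of d] mat_eq_scaleR[of "snd d"] matrix_expand resolvent_def)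
      then have "slack z = mat (snd z)"
        using \<delta> by (metis mat_eq_scaleR mult.commute scaleR_left_imp_eq scaleR_scaleR)
      then have "fst z = 0" by (simp add: slack_def)
      moreover have "0 < axis undefined 1 \<bullet> (fst z *v axis undefined 1)"
        using zD(1) by (simp add: pos_def_def axis_eq_0_iff)
      ultimately show False by simp
    qed
  qed
  ultimately show ?thesis by (cases "?D = 0") auto
qed

lemma subspace_sym_sparse: "subspace (sym_sparse E)"
proof (rule subspaceI)
  show "0 \<in> sym_sparse E" by (simp add: sym_sparse_def sym_mat_def transpose_def vec_eq_iff)
  show "x + y \<in> sym_sparse E" if "x \<in> sym_sparse E" "y \<in> sym_sparse E" for x y
    using that unfolding sym_sparse_def sym_mat_def by (force simp: transpose_expand)
  show "c *\<^sub>R x \<in> sym_sparse E" if "x \<in> sym_sparse E" for c x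
    using that unfolding sym_sparse_def sym_mat_def by (force simp: transpose_expand)
qed

lemma hess_op_coercive:
  assumes S: "pos_def S" and C: "compact C" "C \<subseteq> interior_cone E"
  shows "\<exists>m>0. \<forall>z\<in>C. \<forall>d\<in>sym_sparse E. m * (norm d)\<^sup>2 \<le> hess_op S z d \<bullet> d"
proof -
  let ?B = "C \<times> (sym_sparse E \<inter> sphere 0 1)"
  have cB: "compact ?B"
    by (intro compact_Times C closed_Int_compact closed_subspace subspace_sym_sparse compact_sphere)
  have cont: "continuous_on ?B (\<lambda>(z, d). hess_op S z d \<bullet> d)"
    by (rule continuous_on_subset[OF continuous_on_hess_op[OF C(2)]]) auto
  have scale: "(norm d)\<^sup>2 * (hess_op S z ((1 / norm d) *\<^sub>R d) \<bullet> ((1 / norm d) *\<^sub>R d)) = hess_op S z d \<bullet> d"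
    if "d \<noteq> 0" for z d
    using that by (simp add: linear_cmul[OF linear_hess_op] power2_eq_square)
  have mem: "(z, (1 / norm d) *\<^sub>R d) \<in> ?B" if "z \<in> C" "d \<in> sym_sparse E" "d \<noteq> 0" for z d
    using that by (auto intro: subspace_scale[OF subspace_sym_sparse])
  show ?thesis
  proof (cases "?B = {}")
    case True
    then show ?thesis using mem by (intro exI[of _ 1]) fastforce
  next
    case False
    then obtain b where b: "b \<in> ?B" "\<And>c. c \<in> ?B \<Longrightarrow>
        (case b of (z, d) \<Rightarrow> hess_op S z d \<bullet> d) \<le> (case c of (z, d) \<Rightarrow> hess_op S z d \<bullet> d)"
      using continuous_attains_inf[OF cB _ cont] by blast
    define m where "m = (case b of (z, d) \<Rightarrow> hess_op S z d \<bullet> d)"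
    have "m > 0"
    proof -
      obtain z d where zd: "b = (z, d)" by (cases b)
      then have "z \<in> interior_cone E" "sym_mat (fst d)" "d \<noteq> 0"
        using b(1) C(2) by (auto simp: sym_sparse_def)
      then show ?thesis using hess_op_pos[OF S] by (simp add: m_def zd)
    qed
    moreover have "m * (norm d)\<^sup>2 \<le> hess_op S z d \<bullet> d" if "z \<in> C" "d \<in> sym_sparse E" for z d
    proof (cases "d = 0")
      case False
      have "m \<le> hess_op S z ((1 / norm d) *\<^sub>R d) \<bullet> ((1 / norm d) *\<^sub>R d)"
        using b(2)[OF mem[OF that False]] by (simp add: m_def)
      from mult_left_mono[OF this, of "(norm d)\<^sup>2"] show ?thesis
        unfolding scale[OF False] by (simp add: mult.commute)
    qed (simp add: linear_0[OF linear_hess_op])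
    ultimately show ?thesis by blast
  qed
qed

text \<open>
  Stated for arbitrary square matrices: the symmetric ones do not form an open set.
\<close>

lemma open_pos_quadratic_form: "open {A :: real^'n^'n. \<forall>x. x \<noteq> 0 \<longrightarrow> 0 < x \<bullet> (A *v x)}"
proof -
  have "bounded_bilinear ((*v) :: real^'n^'n \<Rightarrow> real^'n \<Rightarrow> real^'n)"
    unfolding bilinear_conv_bounded_bilinear[symmetric] bilinear_def
    by (auto intro!: linearI simp: algebra_simps scaleR_matrix_vector_assoc[symmetric] matrix_vector_mult_scaleR)
  then obtain K where K: "K > 0" "\<And>(A :: real^'n^'n) x. norm (A *v x) \<le> norm A * norm x * K"
    using bounded_bilinear.pos_bounded by blast
  show ?thesis
    unfolding open_dist
  proof
    fix A :: "real^'n^'n" assume "A \<in> {A. \<forall>x. x \<noteq> 0 \<longrightarrow> 0 < x \<bullet> (A *v x)}"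
    then have A: "\<And>x. x \<noteq> 0 \<Longrightarrow> 0 < x \<bullet> (A *v x)" by blast
    obtain c where c: "c > 0" "\<And>x. c * (norm x)\<^sup>2 \<le> x \<bullet> (A *v x)"
      using quadratic_form_lower_bound[OF A] by blast
    have "0 < x \<bullet> (B *v x)" if B: "dist B A < c / K" and x: "x \<noteq> 0" for B x
    proof -
      have "\<bar>x \<bullet> ((A - B) *v x)\<bar> \<le> norm x * norm ((A - B) *v x)" by (rule Cauchy_Schwarz_ineq2)
      also have "\<dots> \<le> norm x * (norm (A - B) * norm x * K)" by (intro mult_left_mono K) auto
      also have "\<dots> = (norm (A - B) * K) * (norm x)\<^sup>2" by (simp add: power2_eq_square)
      also have "\<dots> < c * (norm x)\<^sup>2"
        using B x K(1) by (intro mult_strict_right_mono) (auto simp: dist_norm norm_minus_commute field_simps)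
      also have "\<dots> \<le> x \<bullet> (A *v x)" by (rule c)
      finally show ?thesis by (simp add: matrix_vector_mult_diff_rdistrib inner_diff_right)
    qed
    then show "\<exists>e>0. \<forall>B. dist B A < e \<longrightarrow> B \<in> {A. \<forall>x. x \<noteq> 0 \<longrightarrow> 0 < x \<bullet> (A *v x)}"
      using c(1) K(1) by (intro exI[of _ "c / K"]) auto
  qed
qed

lemma sym_slack: "d \<in> sym_sparse E \<Longrightarrow> sym_mat (slack d)"
  by (simp add: sym_sparse_def sym_mat_def slack_def transpose_expand)

lemma openin_interior_cone: "openin (top_of_set (sym_sparse E)) (interior_cone E)"
proof -
  let ?O = "{A :: real^'a^'a. \<forall>x. x \<noteq> 0 \<longrightarrow> 0 < x \<bullet> (A *v x)}"
  have eq: "interior_cone E = sym_sparse E \<inter> (fst -` ?O \<inter> slack -` ?O)"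
    using sym_slack by (auto simp: interior_cone_def pos_def_def) (auto simp: sym_sparse_def)
  have "open (slack -` ?O)"
    by (intro open_vimage open_pos_quadratic_form linear_continuous_on bounded_linear_slack)
  then have "open (fst -` ?O \<inter> slack -` ?O)"
    by (intro open_Int open_vimage_fst open_pos_quadratic_form)
  then show ?thesis unfolding eq by (rule openin_open_Int)
qed

lemma convex_interior_cone: "convex (interior_cone E)"
proof (rule convexI)
  fix x y :: "(real^'a^'a) \<times> real" and u v :: real
  assume x: "x \<in> interior_cone E" and y: "y \<in> interior_cone E" and uv: "0 \<le> u" "0 \<le> v" "u + v = 1"
  show "u *\<^sub>R x + v *\<^sub>R y \<in> interior_cone E"
    using x y uv subspace_sym_sparse[of E]
    by (auto simp: interior_cone_def slack_add slack_scaleR intro!: pos_def_comb subspace_add subspace_scale)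
qed

lemma continuous_on_resolvent: "continuous_on (interior_cone E) resolvent"
  unfolding resolvent_def
  by (rule continuous_on_matrix_inv[OF continuous_on_slack[OF continuous_on_id]]) (rule interior_coneD)

lemma objective_eq:
  assumes z: "z \<in> interior_cone E"
  shows "objective S \<rho> z = - ln (det (fst z)) + (snd z * (\<rho>\<^sup>2 - trace S) + (snd z)\<^sup>2 * trace (resolvent z ** S))"
  using interior_coneD(7)[OF z]
  by (cases z) (simp add: objective_def frob_def resolvent_def slack_def)

lemma continuous_on_objective: "continuous_on (interior_cone E) (objective S \<rho>)"
proof -
  have "continuous_on (interior_cone E)
      (\<lambda>z. - ln (det (fst z)) + (snd z * (\<rho>\<^sup>2 - trace S) + (snd z)\<^sup>2 * trace (resolvent z ** S)))"
    by (intro continuous_on_add continuous_on_minus continuous_on_ln continuous_on_det continuous_on_mult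
        continuous_on_power continuous_on_trace continuous_on_matrix_mult continuous_on_resolvent
        continuous_on_fst continuous_on_snd continuous_on_const continuous_on_id)
      (use interior_coneD(1) pos_def_det in \<open>force\<close>)
  then show ?thesis by (rule continuous_on_eq) (simp add: objective_eq)
qed

text \<open>
  The logarithm is differentiated directly, the rest through its expansion on a compact
  neighbourhood of \<open>z\<close> in the subspace.
\<close>

lemma objective_derivative:
  assumes z: "z \<in> interior_cone E" and S: "transpose S = S" and d: "d \<in> sym_sparse E"
  shows "((\<lambda>t. objective S \<rho> (z + t *\<^sub>R d)) has_real_derivative grad_op S \<rho> z \<bullet> d) (at 0)"
proof -
  note zD = interior_coneD[OF z]
  have "{z} \<subseteq> interior_cone E" using z by simp
  then obtain C r where C: "compact C" "convex C" "C \<subseteq> interior_cone E" "r > 0"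
    "\<And>y v. y \<in> {z} \<Longrightarrow> v \<in> sym_sparse E \<Longrightarrow> norm v \<le> r \<Longrightarrow> y + v \<in> C"
    using compact_enlarge_in_openin[OF subspace_sym_sparse openin_interior_cone convex_interior_cone compact_sing]
    by metis
  define e where "e = r / (norm d + 1)"
  have e: "e > 0" using C(4) by (simp add: e_def add_nonneg_pos)
  have inC: "z + s *\<^sub>R d \<in> C" if s: "s \<in> {-e<..<e}" for s
  proof -
    have "norm (s *\<^sub>R d) \<le> \<bar>s\<bar> * (norm d + 1)" by (simp add: mult_left_mono)
    also have "\<dots> \<le> e * (norm d + 1)" using s by (intro mult_right_mono) auto
    also have "\<dots> = r" unfolding e_def by (simp add: add_nonneg_eq_0_iff)
    finally show ?thesis using C(5)[of z "s *\<^sub>R d"] d subspace_sym_sparse[of E] by (simp add: subspace_scale)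
  qed
  let ?q = "\<lambda>z. snd z * (\<rho>\<^sup>2 - trace S) + (snd z)\<^sup>2 * trace (resolvent z ** S)"
  let ?q' = "\<lambda>z d. snd d * (\<rho>\<^sup>2 - trace S) + 2 * snd z * snd d * trace (resolvent z ** S)
        - (snd z)\<^sup>2 * trace (resolvent z ** slack d ** resolvent z ** S)"
  have lin: "linear (?q' z)" for z
    by (rule linearI) (simp_all add: slack_add slack_scaleR matrix_expand trace_expand algebra_simps)
  have "((\<lambda>s. ?q (z + s *\<^sub>R d)) has_vector_derivative ?q' (z + 0 *\<^sub>R d) d) (at 0 within {-e<..<e})"
    by (rule quad_approx_line[OF quad_approx_transport[OF C(1,3)] lin inC]) (use e in auto)
  then have 1: "((\<lambda>s. ?q (z + s *\<^sub>R d)) has_real_derivative ?q' z d) (at 0)"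
    using e by (simp add: has_real_derivative_iff_has_vector_derivative at_within_open[of 0 "{-e<..<e}"])
  have 2: "((\<lambda>t. ln (det (fst z + t *\<^sub>R fst d))) has_real_derivative trace (matrix_inv (fst z) ** fst d)) (at 0)"
    by (rule log_det_derivative[OF zD(1)])
  have eq: "- trace (matrix_inv (fst z) ** fst d) + ?q' z d = grad_op S \<rho> z \<bullet> d"
  proof -
    let ?M = "resolvent z" and ?W = "slack d"
    have D: "fst d = snd d *\<^sub>R mat 1 - ?W" by (simp add: slack_def mat_eq_scaleR[of "snd d"])
    have rot: "trace (?M ** B) = trace (B ** ?M)" "trace (?W ** B) = trace (B ** ?W)" for B
      by (rule trace_mul_sym)+
    have "(?M ** S ** ?M) \<bullet> fst d = snd d * trace (?M ** ?M ** S) - trace (?M ** ?W ** ?M ** S)"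
      unfolding D
    by (simp only: inner_eq_trace transpose_expand zD S matrix_expand trace_expand, simp only: rot matrix_mul_assoc[symmetric])
    then show ?thesis
      by (simp add: grad_op_def Let_def inner_prod_def inner_diff_left)
        (simp add: inner_eq_trace zD algebra_simps)
  qed
  have 3: "((\<lambda>t. - ln (det (fst z + t *\<^sub>R fst d)) + ?q (z + t *\<^sub>R d)) has_real_derivative grad_op S \<rho> z \<bullet> d) (at 0)"
    unfolding eq[symmetric] by (rule DERIV_add[OF DERIV_minus[OF 2] 1])
  show ?thesis
  proof (rule has_field_derivative_transform_within_open[OF 3, of "{-e<..<e}"])
    fix t assume "t \<in> {-e<..<e}"
    then have "z + t *\<^sub>R d \<in> interior_cone E" using inC C(3) by blast
    from objective_eq[OF this] show "- ln (det (fst z + t *\<^sub>R fst d)) + ?q (z + t *\<^sub>R d) = objective S \<rho> (z + t *\<^sub>R d)"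
      by simp
  qed (use e in auto)
qed

section \<open>The Newton system in vectorized form\<close>

text \<open>
  \<open>A V\<close> meets the orthogonal complement of \<open>V\<close> only in \<open>0\<close>, and their dimensions add up to
  that of the whole space; so \<open>- b\<close> is a sum of elements of the two.
\<close>

lemma variational_solution_exists:
  fixes A :: "'a::euclidean_space \<Rightarrow> 'a"
  assumes V: "subspace V" and A: "linear A" and pos: "\<And>d. d \<in> V \<Longrightarrow> d \<noteq> 0 \<Longrightarrow> 0 < A d \<bullet> d"
  obtains d where "d \<in> V" "\<And>v. v \<in> V \<Longrightarrow> (A d + b) \<bullet> v = 0"
proof -
  let ?O = "{y. \<forall>v\<in>V. orthogonal v y}"
  have O: "subspace ?O" by (rule subspace_orthogonal_to_vectors)
  have AV: "subspace (A ` V)" using A V by (rule linear_subspace_image)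
  have "inj_on A V"
  proof (rule inj_onI)
    fix x y assume xy: "x \<in> V" "y \<in> V" "A x = A y"
    have "A (x - y) = 0" using xy(3) by (simp add: linear_diff[OF A])
    then show "x = y" using pos[of "x - y"] xy V by (force simp: subspace_diff)
  qed
  then have dimA: "dim (A ` V) = dim V"
    by (intro dim_image_eq A) (simp add: span_eq_iff[THEN iffD2, OF V])
  have "A ` V \<inter> ?O = {0}"
  proof
    show "A ` V \<inter> ?O \<subseteq> {0}"
    proof
      fix y assume y: "y \<in> A ` V \<inter> ?O"
      then obtain d where d: "d \<in> V" "y = A d" by blast
      have "A d \<bullet> d = 0" using y d by (auto simp: orthogonal_def inner_commute)
      then have "d = 0" using pos[OF d(1)] by fastforce
      then show "y \<in> {0}" using d linear_0[OF A] by simp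
    qed
    show "{0} \<subseteq> A ` V \<inter> ?O" using subspace_0[OF AV] subspace_0[OF O] by auto
  qed
  then have "dim {x + y |x y. x \<in> A ` V \<and> y \<in> ?O} = dim V + dim ?O"
    using dim_sums_Int[OF AV O] dimA by simp
  also have "\<dots> = DIM('a)"
    using dim_subspace_orthogonal_to_vectors[OF V subspace_UNIV] by (simp add: add.commute)
  finally have "{x + y |x y. x \<in> A ` V \<and> y \<in> ?O} = UNIV"
    using dim_eq_full[of "{x + y |x y. x \<in> A ` V \<and> y \<in> ?O}"]
      span_eq_iff[THEN iffD2, OF subspace_sums[OF AV O]] by metis
  then obtain d y where dy: "d \<in> V" "y \<in> ?O" "- b = A d + y" by blast
  have "A d + b = - y" using dy(3) by (metis add.commute add_diff_cancel_left' diff_minus_eq_add minus_add_cancel minus_diff_eq)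
  then show thesis using that[OF dy(1)] dy(2) by (simp add: orthogonal_def inner_commute)
qed

text \<open>
  An isometry into the coordinate space, by which the vectorized system can be tested
  against displacements.
\<close>

definition embed :: "(real^'p^'p) \<times> real \<Rightarrow> real^('p \<times> 'p + unit)" where
  "embed d = append_entry (vec_cols (fst d)) (snd d)"

lemma inner_append_entry: "append_entry v c \<bullet> append_entry w e = v \<bullet> w + c * (e::real)"
  unfolding inner_vec_def UNIV_Plus_UNIV[symmetric]
  by (subst sum.Plus) (auto simp: append_entry_def UNIV_unit)

lemma inner_vec_cols: "vec_cols A \<bullet> vec_cols B = A \<bullet> B"
proof -
  have "vec_cols A \<bullet> vec_cols B = (\<Sum>(j, i)\<in>UNIV \<times> UNIV. A $ i $ j * B $ i $ j)"
    by (simp add: inner_vec_def vec_cols_def case_prod_beta flip: UNIV_Times_UNIV)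
  also have "\<dots> = (\<Sum>j\<in>UNIV. \<Sum>i\<in>UNIV. A $ i $ j * B $ i $ j)"
    by (rule sum.cartesian_product[symmetric])
  also have "\<dots> = A \<bullet> B" unfolding inner_vec_def by (subst sum.swap) simp
  finally show ?thesis .
qed

lemma inner_embed: "embed d \<bullet> embed e = d \<bullet> e"
  by (simp add: embed_def inner_append_entry inner_vec_cols inner_prod_def)

lemma vec_cols_add: "vec_cols (A + B) = vec_cols A + vec_cols B"
  by (simp add: vec_cols_def vec_eq_iff)

lemma vec_cols_scaleR: "vec_cols (c *\<^sub>R A) = c *\<^sub>R vec_cols A"
  by (simp add: vec_cols_def vec_eq_iff)

lemma bordered_mult: "bordered A b c *v append_entry v s = append_entry (A *v v + s *\<^sub>R b) (b \<bullet> v + c * s)"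
proof (rule vec_eq_iff[THEN iffD2], rule allI)
  fix k
  have "(bordered A b c *v append_entry v s) $ k = (\<Sum>l\<in>UNIV <+> UNIV. bordered A b c $ k $ l * append_entry v s $ l)"
    by (simp add: matrix_vector_mult_def)
  also have "\<dots> = append_entry (A *v v + s *\<^sub>R b) (b \<bullet> v + c * s) $ k"
    by (subst sum.Plus)
      (auto simp: bordered_def append_entry_def UNIV_unit matrix_vector_mult_def inner_vec_def split: sum.split)
  finally show "(bordered A b c *v append_entry v s) $ k = append_entry (A *v v + s *\<^sub>R b) (b \<bullet> v + c * s) $ k" .
qed

lemma kron_mult_vec_cols: "(A \<otimes>\<^sub>K B) *v vec_cols D = vec_cols (B ** D ** transpose A)"
proof (rule vec_eq_iff[THEN iffD2], rule allI)
  fix r :: "'a \<times> 'a"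
  have "((A \<otimes>\<^sub>K B) *v vec_cols D) $ r
      = (\<Sum>(j, i)\<in>UNIV \<times> UNIV. A $ fst r $ j * B $ snd r $ i * D $ i $ j)"
    by (simp add: matrix_vector_mult_def kron_def vec_cols_def case_prod_beta flip: UNIV_Times_UNIV)
  also have "\<dots> = (\<Sum>j\<in>UNIV. \<Sum>i\<in>UNIV. A $ fst r $ j * B $ snd r $ i * D $ i $ j)"
    by (rule sum.cartesian_product[symmetric])
  also have "\<dots> = vec_cols (B ** D ** transpose A) $ r"
    by (simp add: vec_cols_def matrix_matrix_mult_def transpose_def sum_distrib_right sum_distrib_left mult_ac)
  finally show "((A \<otimes>\<^sub>K B) *v vec_cols D) $ r = vec_cols (B ** D ** transpose A) $ r" .
qed

lemma G_mat_inv: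
  assumes z: "z \<in> interior_cone E"
  shows "matrix_inv (G_mat (fst z) (snd z)) = snd z *\<^sub>R resolvent z"
proof -
  note zD = interior_coneD[OF z]
  have G: "G_mat (fst z) (snd z) = (1 / snd z) *\<^sub>R slack z"
    using zD(4) by (simp add: G_mat_def slack_def mat_eq_scaleR[of "snd z"] scaleR_diff_right)
  show ?thesis
    using zD(4) matrix_inv_eqs[OF zD(6)]
    by (intro matrix_inv_unique)
      (simp_all add: G resolvent_def matrix_mult_scaleR_left matrix_mult_scaleR_right)
qed

lemma resolvent_fst:
  assumes z: "z \<in> interior_cone E"
  shows "resolvent z ** fst z = snd z *\<^sub>R resolvent z - mat 1"
    "fst z ** resolvent z = snd z *\<^sub>R resolvent z - mat 1"
proof -
  note zD = interior_coneD[OF z]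
  have X: "fst z = snd z *\<^sub>R mat 1 - slack z" by (simp add: slack_def mat_eq_scaleR[of "snd z"])
  show "resolvent z ** fst z = snd z *\<^sub>R resolvent z - mat 1"
    "fst z ** resolvent z = snd z *\<^sub>R resolvent z - mat 1"
    unfolding X using matrix_inv_eqs[OF zD(6)]
    by (simp_all add: matrix_expand resolvent_def)
qed

lemma grad_eq_embed:
  assumes z: "z \<in> interior_cone E"
  shows "grad S \<rho> (fst z) (snd z) = embed (grad_op S \<rho> z)"
proof -
  let ?M = "resolvent z"
  note zD = interior_coneD[OF z]
  have r: "trace (?M ** (S ** ?M)) = trace (?M ** (?M ** S))"
    using trace_mul_sym[of "?M ** S" ?M] by (simp add: matrix_mul_assoc)
  show ?thesis
    unfolding grad_def Let_def G_mat_inv[OF z] embed_def grad_op_def fst_conv snd_conv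
  proof (rule arg_cong2[where f = append_entry])
    show "vec_cols (snd z *\<^sub>R ?M ** S ** snd z *\<^sub>R ?M - matrix_inv (fst z))
        = vec_cols ((snd z)\<^sup>2 *\<^sub>R (?M ** S ** ?M) - matrix_inv (fst z))"
      by (simp add: matrix_expand power2_eq_square)
    show "\<rho>\<^sup>2 + trace (snd z *\<^sub>R ?M ** S ** (mat 1 - (1 / snd z) *\<^sub>R (snd z *\<^sub>R ?M ** fst z)) - S)
        = \<rho>\<^sup>2 - trace S + 2 * snd z * trace (?M ** S) - (snd z)\<^sup>2 * trace (?M ** ?M ** S)"
      using zD(4)
    by (simp only: matrix_expand trace_expand resolvent_fst[OF z] r, simp add: field_simps power2_eq_square)
  qed
qed

text \<open>
  For \<open>D = fst d\<close> the Kronecker block yields \<open>2 \<gamma>\<^sup>2 M D M S M\<close> where the derivative of the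
  gradient has \<open>\<gamma>\<^sup>2 (M D M S M + M S M D M)\<close>. These differ by an antisymmetric matrix, which
  is orthogonal to every symmetric one.
\<close>

lemma hess_form:
  assumes z: "z \<in> interior_cone E" and S: "transpose S = S"
    and d: "transpose (fst d) = fst d" and v: "transpose (fst v) = fst v"
  shows "(hess S (fst z) (snd z) *v embed d) \<bullet> embed v = hess_op S z d \<bullet> v"
proof -
  note zD = interior_coneD[OF z]
  define M where "M = resolvent z"
  define Xi where "Xi = matrix_inv (fst z)"
  obtain D \<delta> where dd: "d = (D, \<delta>)" by (cases d)
  obtain V \<nu> where vv: "v = (V, \<nu>)" by (cases v)
  define \<gamma> where "\<gamma> = snd z"
  have \<gamma>: "\<gamma> > 0" using zD by (simp add: \<gamma>_def)
  have sym: "transpose M = M" "transpose Xi = Xi" "transpose S = S" "transpose D = D" "transpose V = V"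
    using zD S d v by (simp_all add: M_def Xi_def dd vv)
  have Gi: "matrix_inv (G_mat (fst z) (snd z)) = \<gamma> *\<^sub>R M"
    unfolding G_mat_inv[OF z] by (simp add: M_def \<gamma>_def)
  have XM: "fst z ** M = \<gamma> *\<^sub>R M - mat 1" "M ** fst z = \<gamma> *\<^sub>R M - mat 1"
    unfolding M_def \<gamma>_def by (rule resolvent_fst[OF z])+
  have XM': "fst z ** (M ** Z) = (\<gamma> *\<^sub>R M - mat 1) ** Z" for Z
    by (simp add: matrix_mul_assoc XM)
  have MX': "M ** (fst z ** Z) = (\<gamma> *\<^sub>R M - mat 1) ** Z" for Z
    by (simp add: matrix_mul_assoc XM)
  define h where "h = (2 * \<gamma>) *\<^sub>R (M ** S ** M) - \<gamma>\<^sup>2 *\<^sub>R (M ** M ** S ** M + M ** S ** M ** M)"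
  have h: "- (1 / \<gamma>\<^sup>2) *\<^sub>R (\<gamma> *\<^sub>R M ** (fst z ** \<gamma> *\<^sub>R M ** S + S ** \<gamma> *\<^sub>R M ** fst z) ** \<gamma> *\<^sub>R M) = h"
    using \<gamma> unfolding h_def
    by (simp only: matrix_expand XM XM' MX', simp add: vec_eq_iff field_simps power2_eq_square)
  have c: "2 / \<gamma> ^ 3 * trace (\<gamma> *\<^sub>R M ** fst z ** \<gamma> *\<^sub>R M ** S ** \<gamma> *\<^sub>R M ** fst z)
      = 2 * \<gamma>\<^sup>2 * trace (M ** M ** M ** S) - 4 * \<gamma> * trace (M ** M ** S) + 2 * trace (M ** S)"
  proof -
    have r: "trace (M ** (M ** (S ** M))) = trace (M ** (M ** (M ** S)))"
      "trace (M ** (S ** M)) = trace (M ** (M ** S))"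
      using trace_mul_sym[of "M ** M ** S" M] trace_mul_sym[of "M ** S" M] by (simp_all add: matrix_mul_assoc)
    show ?thesis
      using \<gamma> by (simp add: matrix_expand XM XM' MX' trace_expand r)
        (simp add: field_simps power2_eq_square power3_eq_cube)
  qed
  have kr: "((Xi \<otimes>\<^sub>K Xi) + ((2 / \<gamma>) *\<^sub>R (\<gamma> *\<^sub>R M ** S ** \<gamma> *\<^sub>R M)) \<otimes>\<^sub>K (\<gamma> *\<^sub>R M)) *v vec_cols D
      = vec_cols (Xi ** D ** Xi + (2 * \<gamma>\<^sup>2) *\<^sub>R (M ** D ** M ** S ** M))"
    using \<gamma> by (simp add: matrix_vector_mult_add_rdistrib kron_mult_vec_cols vec_cols_add[symmetric]
        transpose_expand sym matrix_expand power2_eq_square mult.assoc)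
  have "(hess S (fst z) (snd z) *v embed d) \<bullet> embed v =
     (Xi ** D ** Xi + (2 * \<gamma>\<^sup>2) *\<^sub>R (M ** D ** M ** S ** M) + \<delta> *\<^sub>R h) \<bullet> V
     + (h \<bullet> D + (2 * \<gamma>\<^sup>2 * trace (M ** M ** M ** S) - 4 * \<gamma> * trace (M ** M ** S) + 2 * trace (M ** S)) * \<delta>) * \<nu>"
    unfolding hess_def Let_def Gi
    unfolding \<gamma>_def[symmetric] Xi_def[symmetric] c
    unfolding vec_cols_scaleR[symmetric] h embed_def dd vv fst_conv snd_conv bordered_mult kr
    by (simp add: inner_append_entry inner_vec_cols vec_cols_add[symmetric] vec_cols_scaleR[symmetric])
  also have "\<dots> = hess_op S z d \<bullet> v"
  proof -
    have rot: "trace (M ** B) = trace (B ** M)" "trace (D ** B) = trace (B ** D)"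
       "trace (V ** B) = trace (B ** V)" for B
      by (rule trace_mul_sym)+
    have tr: "trace (S ** (M ** (D ** (M ** (V ** M))))) = trace (S ** (M ** (V ** (M ** (D ** M)))))"
      using trace_transpose[of "S ** (M ** (D ** (M ** (V ** M))))"]
      by (simp only: transpose_expand sym rot matrix_mul_assoc[symmetric])
    show ?thesis
      unfolding hess_op_def Let_def h_def dd vv slack_def fst_conv snd_conv inner_prod_def
        M_def[symmetric] \<gamma>_def[symmetric] Xi_def[symmetric] mat_eq_scaleR[of \<delta>] inner_real_def
    by (simp only: inner_eq_trace transpose_expand sym matrix_expand trace_expand, simp only: rot matrix_mul_assoc[symmetric] tr, simp add: algebra_simps power2_eq_square)
  qed
  finally show ?thesis .
qed

lemma sparsity_proj_embed:
  assumes E: "sym E"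
  obtains p where "p \<in> sym_sparse E" "sparsity_proj E w = embed p"
proof
  let ?P = "\<chi> i j. if (i, j) \<in> E then 0 else 1 / 2 * w $ Inl (j, i) + 1 / 2 * w $ Inl (i, j)"
  have "(i, j) \<in> E \<longleftrightarrow> (j, i) \<in> E" for i j using E by (meson symE)
  then show "(?P, w $ Inr ()) \<in> sym_sparse E"
    by (auto simp: sym_sparse_def sym_mat_def transpose_def vec_eq_iff)
  show "sparsity_proj E w = embed (?P, w $ Inr ())"
    by (auto simp: sparsity_proj_def embed_def append_entry_def vec_cols_def vec_eq_iff split: sum.split)
qed

text \<open>
  The projection is self-adjoint and fixes the vectors \<open>embed v\<close>; the computation swaps the
  two summation indices in one half of the sum.
\<close>

lemma inner_sparsity_proj:
  assumes v: "v \<in> sym_sparse E"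
  shows "sparsity_proj E w \<bullet> embed v = w \<bullet> embed v"
proof -
  have sym: "fst v $ i $ j = fst v $ j $ i" for i j
    using v unfolding sym_sparse_def sym_mat_def transpose_def by (metis (mono_tags, lifting) mem_Collect_eq vec_lambda_beta)
  have zero: "fst v $ i $ j = 0" if "(i, j) \<in> E" for i j using v that by (auto simp: sym_sparse_def)
  have sum: "x \<bullet> embed v = (\<Sum>j\<in>UNIV. \<Sum>i\<in>UNIV. x $ Inl (j, i) * fst v $ i $ j) + x $ Inr () * snd v" for x
  proof -
    have "x \<bullet> embed v = (\<Sum>k\<in>UNIV <+> UNIV. x $ k * embed v $ k)" by (simp add: inner_vec_def)
    also have "\<dots> = (\<Sum>(j, i)\<in>UNIV \<times> UNIV. x $ Inl (j, i) * fst v $ i $ j) + x $ Inr () * snd v"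
      by (subst sum.Plus) (auto simp: embed_def append_entry_def vec_cols_def UNIV_unit case_prod_beta)
    finally show ?thesis by (simp only: sum.cartesian_product)
  qed
  have "(\<Sum>j\<in>UNIV. \<Sum>i\<in>UNIV. sparsity_proj E w $ Inl (j, i) * fst v $ i $ j)
     = (\<Sum>j\<in>UNIV. \<Sum>i\<in>UNIV. 1 / 2 * (w $ Inl (j, i) * fst v $ i $ j) + 1 / 2 * (w $ Inl (i, j) * fst v $ j $ i))"
  proof (intro sum.cong refl)
    fix j i
    show "sparsity_proj E w $ Inl (j, i) * fst v $ i $ j
        = 1 / 2 * (w $ Inl (j, i) * fst v $ i $ j) + 1 / 2 * (w $ Inl (i, j) * fst v $ j $ i)"
      unfolding sym[of j i] by (simp add: sparsity_proj_def zero algebra_simps)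
  qed
  also have "\<dots> = 1 / 2 * (\<Sum>j\<in>UNIV. \<Sum>i\<in>UNIV. w $ Inl (j, i) * fst v $ i $ j)
      + 1 / 2 * (\<Sum>j\<in>UNIV. \<Sum>i\<in>UNIV. w $ Inl (i, j) * fst v $ j $ i)"
    by (simp only: sum.distrib sum_distrib_left)
  also have "(\<Sum>j\<in>UNIV. \<Sum>i\<in>UNIV. w $ Inl (i, j) * fst v $ j $ i)
      = (\<Sum>j\<in>UNIV. \<Sum>i\<in>UNIV. w $ Inl (j, i) * fst v $ i $ j)"
    by (rule sum.swap)
  finally show ?thesis by (simp add: sum) (simp add: sparsity_proj_def)
qed

text \<open>
  The projected vector is itself of the form \<open>embed p\<close>; testing with \<open>p\<close> yields its squared
  norm.
\<close>

lemma sparsity_proj_eq_0_iff: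
  assumes "sym E"
  shows "sparsity_proj E w = 0 \<longleftrightarrow> (\<forall>v\<in>sym_sparse E. w \<bullet> embed v = 0)"
proof
  assume "sparsity_proj E w = 0"
  then show "\<forall>v\<in>sym_sparse E. w \<bullet> embed v = 0" using inner_sparsity_proj by (metis inner_zero_left)
next
  assume *: "\<forall>v\<in>sym_sparse E. w \<bullet> embed v = 0"
  obtain p where p: "p \<in> sym_sparse E" "sparsity_proj E w = embed p"
    using sparsity_proj_embed[OF assms] .
  then have "embed p \<bullet> embed p = 0" using * inner_sparsity_proj[OF p(1), of w] by auto
  then show "sparsity_proj E w = 0" using p(2) by simp
qed

lemma sym_sparseD: "d \<in> sym_sparse E \<Longrightarrow> transpose (fst d) = fst d"
  by (simp add: sym_sparse_def sym_mat_def)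

lemma is_direction_iff:
  assumes E: "sym E" and S: "pos_def S" and z: "z \<in> interior_cone E"
  shows "is_direction S \<rho> E z d \<longleftrightarrow>
    d \<in> sym_sparse E \<and> (\<forall>v\<in>sym_sparse E. (hess_op S z d + grad_op S \<rho> z) \<bullet> v = 0)"
proof -
  have tS: "transpose S = S" using S by (simp add: pos_def_def sym_mat_def)
  have "(hess S (fst z) (snd z) *v embed d + grad S \<rho> (fst z) (snd z)) \<bullet> embed v
      = (hess_op S z d + grad_op S \<rho> z) \<bullet> v" if "d \<in> sym_sparse E" "v \<in> sym_sparse E" for v
    using hess_form[OF z tS sym_sparseD[OF that(1)] sym_sparseD[OF that(2)]]
    by (simp add: grad_eq_embed[OF z] inner_embed inner_add_left)
  then show ?thesis
    by (cases z; cases d)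
      (auto simp: is_direction_def sparsity_proj_eq_0_iff[OF E] sym_sparse_def embed_def)
qed

lemma direction_props:
  assumes E: "sym E" and S: "pos_def S" and z: "z \<in> interior_cone E"
  shows "direction S \<rho> E z \<in> sym_sparse E"
    "\<And>v. v \<in> sym_sparse E \<Longrightarrow> (hess_op S z (direction S \<rho> E z) + grad_op S \<rho> z) \<bullet> v = 0"
proof -
  have pos: "0 < hess_op S z d \<bullet> d" if "d \<in> sym_sparse E" "d \<noteq> 0" for d
    using hess_op_pos[OF S z] that by (simp add: sym_sparse_def)
  obtain d where d: "d \<in> sym_sparse E" "\<And>v. v \<in> sym_sparse E \<Longrightarrow> (hess_op S z d + grad_op S \<rho> z) \<bullet> v = 0"
    using variational_solution_exists[OF subspace_sym_sparse linear_hess_op pos] by blast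
  have "is_direction S \<rho> E z (direction S \<rho> E z)"
    unfolding direction_def
  proof (rule theI)
    show "is_direction S \<rho> E z d" using d by (simp add: is_direction_iff[OF assms])
    fix e assume "is_direction S \<rho> E z e"
    then have e: "e \<in> sym_sparse E" "\<And>v. v \<in> sym_sparse E \<Longrightarrow> (hess_op S z e + grad_op S \<rho> z) \<bullet> v = 0"
      by (auto simp: is_direction_iff[OF assms])
    have ed: "e - d \<in> sym_sparse E" by (rule subspace_diff[OF subspace_sym_sparse e(1) d(1)])
    have "hess_op S z (e - d) \<bullet> (e - d) = 0"
      using e(2)[OF ed] d(2)[OF ed] by (simp add: linear_diff[OF linear_hess_op] inner_diff_left inner_add_left)
    then show "e = d" using pos[OF ed] by fastforce
  qed
  then show "direction S \<rho> E z \<in> sym_sparse E"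
    "\<And>v. v \<in> sym_sparse E \<Longrightarrow> (hess_op S z (direction S \<rho> E z) + grad_op S \<rho> z) \<bullet> v = 0"
    by (auto simp: is_direction_iff[OF assms])
qed

lemma slope_eq:
  assumes "z \<in> interior_cone E"
  shows "slope S \<rho> z d = grad_op S \<rho> z \<bullet> d"
  using grad_eq_embed[OF assms, of S \<rho>] inner_embed[of "grad_op S \<rho> z" d]
  by (cases z; cases d) (simp add: slope_def embed_def)

lemma cond1_iff:
  assumes "z \<in> interior_cone E" "d \<in> sym_sparse E"
  shows "cond1 z d \<alpha> \<longleftrightarrow> z + \<alpha> *\<^sub>R d \<in> interior_cone E"
proof -
  have "z + \<alpha> *\<^sub>R d \<in> sym_sparse E"
    using assms subspace_sym_sparse by (auto simp: interior_cone_def intro!: subspace_add subspace_scale)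
  then show ?thesis
    by (cases z; cases d) (auto simp: cond1_def interior_cone_def loewner_greater_def slack_def)
qed

lemma step_size_props:
  assumes z: "z \<in> interior_cone E" and d: "d \<in> sym_sparse E"
    and acc: "z + (1 / 2 ^ m) *\<^sub>R d \<in> interior_cone E"
      "objective S \<rho> (z + (1 / 2 ^ m) *\<^sub>R d) \<le> objective S \<rho> z + \<sigma> * (1 / 2 ^ m) * (grad_op S \<rho> z \<bullet> d)"
  defines "s \<equiv> step_size S \<rho> \<sigma> z d"
  shows "(\<exists>n::nat. s = 1 / 2 ^ n) \<and> 1 / 2 ^ m \<le> s \<and> z + s *\<^sub>R d \<in> interior_cone E
    \<and> objective S \<rho> (z + s *\<^sub>R d) \<le> objective S \<rho> z + \<sigma> * s * (grad_op S \<rho> z \<bullet> d)"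
proof -
  define Q where "Q \<alpha> \<longleftrightarrow> cond1 z d \<alpha> \<and> cond2 S \<rho> \<sigma> z d \<alpha>" for \<alpha>
  have Q: "Q \<alpha> \<longleftrightarrow> z + \<alpha> *\<^sub>R d \<in> interior_cone E
      \<and> objective S \<rho> (z + \<alpha> *\<^sub>R d) \<le> objective S \<rho> z + \<sigma> * \<alpha> * (grad_op S \<rho> z \<bullet> d)" for \<alpha>
    by (simp add: Q_def cond1_iff[OF z d] cond2_def slope_eq[OF z])
  define n where "n = (LEAST n::nat. Q (1 / 2 ^ n))"
  have Qm: "Q (1 / 2 ^ m)" using acc by (simp add: Q)
  then have Qn: "Q (1 / 2 ^ n)" unfolding n_def by (rule LeastI)
  have le: "1 / 2 ^ k \<le> (1 / 2 ^ n :: real)" if "Q (1 / 2 ^ k)" for k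
    using Least_le[of "\<lambda>n. Q (1 / 2 ^ n)", OF that] by (simp add: n_def field_simps)
  have "s = 1 / 2 ^ n"
    unfolding s_def step_size_def
    by (rule Greatest_equality) (use Qn le in \<open>auto simp: Q_def\<close>)
  then show ?thesis using Qn le[OF Qm] by (auto simp: Q)
qed

section \<open>Compactness of the sublevel sets\<close>

text \<open>
  From \<open>X = \<gamma> I - M\<^sup>-\<^sup>1\<close> one gets \<open>X M X = \<gamma>\<^sup>2 M - \<gamma> I - X\<close>. The first form displays the
  objective as a sum whose last three terms are nonnegative for positive definite \<open>S\<close>.
\<close>

lemma objective_split:
  assumes z: "z \<in> interior_cone E"
  shows "objective S \<rho> z = - ln (det (fst z)) + trace (S ** fst z) + snd z * \<rho>\<^sup>2
    + trace (S ** (transpose (fst z) ** resolvent z ** fst z))"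
    "(snd z)\<^sup>2 * trace (resolvent z ** S) = snd z * trace S + trace (S ** fst z)
    + trace (S ** (transpose (fst z) ** resolvent z ** fst z))"
proof -
  note zD = interior_coneD[OF z]
  have "transpose (fst z) ** resolvent z ** fst z = (snd z)\<^sup>2 *\<^sub>R resolvent z - snd z *\<^sub>R mat 1 - fst z"
    by (simp add: zD resolvent_fst[OF z] matrix_expand power2_eq_square)
  then have "trace (S ** (transpose (fst z) ** resolvent z ** fst z))
      = (snd z)\<^sup>2 * trace (S ** resolvent z) - snd z * trace S - trace (S ** fst z)"
    by (simp add: matrix_expand trace_expand)
  then show 2: "(snd z)\<^sup>2 * trace (resolvent z ** S) = snd z * trace S + trace (S ** fst z)
    + trace (S ** (transpose (fst z) ** resolvent z ** fst z))"
    by (simp add: trace_mul_sym[of "resolvent z"])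
  show "objective S \<rho> z = - ln (det (fst z)) + trace (S ** fst z) + snd z * \<rho>\<^sup>2
    + trace (S ** (transpose (fst z) ** resolvent z ** fst z))"
    unfolding objective_eq[OF z] using 2 by (simp add: algebra_simps)
qed

text \<open>
  A bound on \<open>tr (Y\<^sup>-\<^sup>1 S)\<close> keeps \<open>Y\<close> away from singular matrices. First
  \<open>s x x\<^sup>T / |x|\<^sup>2 \<le> s I \<le> S\<close> gives \<open>s (x \<bullet> Y\<^sup>-\<^sup>1 x) \<le> tr (Y\<^sup>-\<^sup>1 S) |x|\<^sup>2\<close>; then
  \<open>|x|\<^sup>4 = (x \<bullet> Y Y\<^sup>-\<^sup>1 x)\<^sup>2 \<le> (x \<bullet> Y x) (x \<bullet> Y\<^sup>-\<^sup>1 x)\<close> by the Cauchy-Schwarz inequality of \<open>Y\<close>.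
\<close>

lemma slack_bound_from_trace:
  fixes Y S :: "real^'n^'n"
  assumes Y: "pos_def Y" and S: "sym_mat S" and s: "s > 0" "\<And>x. s * (norm x)\<^sup>2 \<le> x \<bullet> (S *v x)"
  shows "s * (norm x)\<^sup>2 \<le> trace (matrix_inv Y ** S) * (x \<bullet> (Y *v x))"
proof (cases "x = 0")
  case False
  let ?M = "matrix_inv Y"
  define R :: "real^'n^'n" where "R = (\<chi> k l. x $ k * x $ l / ((norm x)\<^sup>2 / s))"
  have R: "R *v y = ((x \<bullet> y) / ((norm x)\<^sup>2 / s)) *\<^sub>R x" for y
    by (simp add: R_def vec_eq_iff matrix_vector_mult_def inner_vec_def sum_distrib_left
        sum_divide_distrib mult_ac)
  have "pos_semidef (S - R)"
    unfolding pos_semidef_def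
  proof
    show "sym_mat (S - R)" using S by (simp add: R_def sym_mat_def transpose_def vec_eq_iff mult.commute)
    show "\<forall>y. 0 \<le> y \<bullet> ((S - R) *v y)"
    proof
      fix y
      have "(x \<bullet> y)\<^sup>2 \<le> (norm x)\<^sup>2 * (norm y)\<^sup>2"
        by (metis Cauchy_Schwarz_ineq power2_norm_eq_inner)
      then have "s * ((x \<bullet> y)\<^sup>2 / (norm x)\<^sup>2) \<le> s * (norm y)\<^sup>2"
        using s(1) False by (intro mult_left_mono) (auto simp: divide_le_eq mult.commute)
      also have "\<dots> \<le> y \<bullet> (S *v y)" by (rule s)
      finally show "0 \<le> y \<bullet> ((S - R) *v y)"
        by (simp add: matrix_vector_mult_diff_rdistrib inner_diff_right R power2_eq_square inner_commute mult_ac)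
    qed
  qed
  then have "0 \<le> trace ((S - R) ** ?M)"
    using pos_def_imp_semidef[OF pos_def_inv[OF Y]] by (rule trace_mult_pos_semidef)
  also have "\<dots> = trace (?M ** S) - (x \<bullet> (?M *v x)) / ((norm x)\<^sup>2 / s)"
    unfolding matrix_mult_rdistrib_diff trace_sub R_def trace_rank_one_mult trace_mul_sym[of S] ..
  finally have M: "s * (x \<bullet> (?M *v x)) \<le> trace (?M ** S) * (norm x)\<^sup>2"
    using s(1) False by (simp add: field_simps)
  have YM: "Y *v (?M *v x) = x"
    using matrix_inv_eqs[OF pos_def_invertible[OF Y]] by (simp add: matrix_vector_mul_assoc)
  have "(x \<bullet> (Y *v (?M *v x)))\<^sup>2 \<le> (x \<bullet> (Y *v x)) * ((?M *v x) \<bullet> (Y *v (?M *v x)))"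
    by (rule pos_semidef_Cauchy_Schwarz[OF pos_def_imp_semidef[OF Y]])
  then have CS: "((norm x)\<^sup>2)\<^sup>2 \<le> (x \<bullet> (Y *v x)) * (x \<bullet> (?M *v x))"
    by (simp add: YM power2_norm_eq_inner inner_commute)
  have "(s * (norm x)\<^sup>2) * (norm x)\<^sup>2 \<le> (x \<bullet> (Y *v x)) * (s * (x \<bullet> (?M *v x)))"
    using mult_left_mono[OF CS, of s] s(1) by (simp add: power2_eq_square mult_ac)
  also have "\<dots> \<le> (x \<bullet> (Y *v x)) * (trace (?M ** S) * (norm x)\<^sup>2)"
    using M Y False by (intro mult_left_mono) (auto simp: pos_def_def less_imp_le)
  finally have "(s * (norm x)\<^sup>2) * (norm x)\<^sup>2 \<le> (trace (?M ** S) * (x \<bullet> (Y *v x))) * (norm x)\<^sup>2"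
    by (simp add: mult_ac)
  then show ?thesis using False by simp
qed simp

lemma norm_matrix_le_sum: "norm A \<le> (\<Sum>i\<in>UNIV. \<Sum>j\<in>UNIV. \<bar>(A :: real^'n^'m) $ i $ j\<bar>)"
proof -
  have "norm A \<le> (\<Sum>i\<in>UNIV. norm (A $ i))" unfolding norm_vec_def by (rule L2_set_le_sum) simp
  also have "\<dots> \<le> (\<Sum>i\<in>UNIV. \<Sum>j\<in>UNIV. \<bar>A $ i $ j\<bar>)" by (intro sum_mono norm_le_l1_cart)
  finally show ?thesis .
qed

text \<open>
  On a sublevel set the tangent inequality \<open>log det X \<le> b + tr (S X)\<close> bounds \<open>\<gamma>\<close> and
  \<open>tr (S X M X)\<close>. Then \<open>X\<close> is bounded because it lies below \<open>\<gamma> I\<close>, its determinant is bounded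
  below by \<open>exp (- c)\<close>, and \<open>\<gamma>\<^sup>2 tr (M S)\<close> is bounded, which keeps \<open>\<gamma> I - X\<close> away from singular
  matrices. These closed conditions define a compact subset \<open>B\<close> of the feasible set, on which
  the objective is continuous.
\<close>

lemma compact_sublevel:
  fixes S :: "real^'p::finite^'p"
  assumes S: "pos_def S" and \<rho>: "\<rho> > 0"
  shows "compact {z \<in> interior_cone E. objective S \<rho> z \<le> c}"
proof -
  obtain s where s: "s > 0" "\<And>x. s * (norm x)\<^sup>2 \<le> x \<bullet> (S *v x)"
    using quadratic_form_lower_bound[of S] S unfolding pos_def_def by blast
  have symS: "sym_mat S" using S by (simp add: pos_def_def)
  have invS: "matrix_inv (matrix_inv S) = S"
    using matrix_inv_eqs[OF pos_def_invertible[OF S]] by (intro matrix_inv_unique)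
  define b where "b = ln (det (matrix_inv S)) - trace (mat 1 :: real^'p^'p)"
  define c1 where "c1 = \<bar>c + b\<bar>"
  define \<Gamma> where "\<Gamma> = c1 / \<rho>\<^sup>2"
  define c2 where "c2 = c1 + 2 * \<Gamma> * trace S + 1"
  have c1: "c1 \<ge> 0" by (simp add: c1_def)
  have \<Gamma>: "\<Gamma> \<ge> 0" using c1 by (simp add: \<Gamma>_def)
  have trS: "0 \<le> trace S"
    using trace_congruence_nonneg[OF S pos_def_mat[of 1], of "mat 1"] by simp
  have c2: "c2 > 0" using c1 \<Gamma> trS by (simp add: c2_def add_nonneg_pos)
  let ?K = "{z \<in> interior_cone E. objective S \<rho> z \<le> c}"
  define B where "B = {z \<in> sym_sparse E. \<bar>snd z\<bar> \<le> \<Gamma> \<and> (\<forall>i j. \<bar>fst z $ i $ j\<bar> \<le> \<Gamma>)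
    \<and> (\<forall>x. 0 \<le> x \<bullet> (fst z *v x)) \<and> exp (- c) \<le> det (fst z)
    \<and> (\<forall>x. (snd z)\<^sup>2 * (s * (norm x)\<^sup>2) \<le> c2 * (x \<bullet> (slack z *v x)))}"
  have mv: "continuous_on UNIV (\<lambda>z :: (real^'p^'p) \<times> real. fst z *v x)"
    "continuous_on UNIV (\<lambda>z :: (real^'p^'p) \<times> real. slack z *v x)" for x :: "real^'p"
  proof -
    have l: "bounded_linear (\<lambda>A :: real^'p^'p. A *v x)"
      unfolding linear_conv_bounded_linear[symmetric]
      by (rule linearI) (simp_all add: matrix_vector_mult_add_rdistrib scaleR_matrix_vector_assoc)
    show "continuous_on UNIV (\<lambda>z :: (real^'p^'p) \<times> real. fst z *v x)"
      by (intro bounded_linear.continuous_on[OF l] continuous_on_fst continuous_on_id)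
    show "continuous_on UNIV (\<lambda>z :: (real^'p^'p) \<times> real. slack z *v x)"
      by (intro bounded_linear.continuous_on[OF l] continuous_on_slack continuous_on_id)
  qed
  have "closed B"
    unfolding B_def
    by (intro closed_Collect_conj closed_Collect_all closed_Collect_le continuous_on_const mv
        continuous_on_inner continuous_on_mult continuous_on_power continuous_on_rabs continuous_on_snd
        continuous_on_fst continuous_on_component continuous_on_det continuous_on_id)
      (simp add: closed_subspace subspace_sym_sparse)
  have "bounded B"
  proof (rule boundedI)
    fix z assume z: "z \<in> B"
    have "norm (fst z) \<le> (\<Sum>i\<in>(UNIV :: 'p set). \<Sum>j\<in>(UNIV :: 'p set). \<Gamma>)"
      using norm_matrix_le_sum[of "fst z"] z by (intro order_trans[OF norm_matrix_le_sum] sum_mono) (auto simp: B_def)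
    moreover have "\<bar>snd z\<bar> \<le> \<Gamma>" using z by (simp add: B_def)
    ultimately show "norm z \<le> (\<Sum>i\<in>(UNIV :: 'p set). \<Sum>j\<in>(UNIV :: 'p set). \<Gamma>) + \<Gamma>"
      using norm_Pair_le[of "fst z" "snd z"] by simp
  qed
  have BF: "B \<subseteq> interior_cone E"
  proof
    fix z assume z: "z \<in> B"
    then have zV: "z \<in> sym_sparse E" by (simp add: B_def)
    have semi: "pos_semidef (fst z)" using z by (auto simp: B_def pos_semidef_def sym_sparse_def)
    have "exp (- c) \<le> det (fst z)" using z by (simp add: B_def)
    then have "det (fst z) \<noteq> 0" by (smt (verit) exp_gt_zero)
    then have inv: "invertible (fst z)" by (simp add: invertible_det_nz)
    have X: "0 < x \<bullet> (fst z *v x)" if "x \<noteq> 0" for x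
    proof -
      have "x \<bullet> (fst z *v x) \<noteq> 0"
      proof
        assume "x \<bullet> (fst z *v x) = 0"
        then have "fst z *v x = 0" by (rule pos_semidef_null[OF semi])
        then have "matrix_inv (fst z) *v (fst z *v x) = 0" by simp
        then show False using that matrix_inv_eqs[OF inv] by (simp add: matrix_vector_mul_assoc)
      qed
      then show ?thesis using semi by (simp add: pos_semidef_def less_le)
    qed
    have slack: "x \<bullet> (slack z *v x) = snd z * (norm x)\<^sup>2 - x \<bullet> (fst z *v x)" for x
      by (simp add: slack_def matrix_vector_mult_diff_rdistrib inner_diff_right mat_vec_mult power2_norm_eq_inner)
    \<comment> \<open>The last condition in \<open>B\<close> first yields semidefiniteness of the slack, hence \<open>\<gamma> > 0\<close>, and only
      then strict positivity.\<close>
    have Y: "0 < x \<bullet> (slack z *v x)" if x: "x \<noteq> 0" for x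
    proof -
      have le: "(snd z)\<^sup>2 * (s * (norm x)\<^sup>2) \<le> c2 * (x \<bullet> (slack z *v x))" using z by (simp add: B_def)
      have "0 \<le> (snd z)\<^sup>2 * (s * (norm x)\<^sup>2)" using s(1) by simp
      then have "0 \<le> x \<bullet> (slack z *v x)" using le c2 by (smt (verit) mult_pos_neg)
      then have "0 < snd z * (norm x)\<^sup>2" using X[OF x] slack[of x] by linarith
      then have "snd z \<noteq> 0" by auto
      then have "0 < (snd z)\<^sup>2 * (s * (norm x)\<^sup>2)" using s(1) x by simp
      then have "0 < c2 * (x \<bullet> (slack z *v x))" using le by linarith
      then show ?thesis using c2 by (simp add: zero_less_mult_iff)
    qed
    show "z \<in> interior_cone E"
      using zV X Y sym_slack[OF zV] by (auto simp: interior_cone_def pos_def_def sym_sparse_def)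
  qed
  have KB: "?K \<subseteq> B"
  proof
    fix z assume "z \<in> ?K"
    then have z: "z \<in> interior_cone E" and fz: "objective S \<rho> z \<le> c" by auto
    note zD = interior_coneD[OF z]
    let ?T = "trace (S ** (transpose (fst z) ** resolvent z ** fst z))"
    have T: "0 \<le> ?T" by (rule trace_congruence_nonneg[OF S zD(3)])
    have trX: "0 \<le> trace (S ** fst z)" using trace_congruence_nonneg[OF S zD(1), of "mat 1"] by simp
    have trY: "0 \<le> trace (S ** slack z)" using trace_congruence_nonneg[OF S zD(2), of "mat 1"] by simp
    have trX': "trace (S ** fst z) \<le> snd z * trace S"
      using trY by (simp add: slack_def mat_eq_scaleR[of "snd z"] matrix_expand trace_expand)
    have "ln (det (fst z)) \<le> ln (det (matrix_inv S)) + trace (S ** (fst z - matrix_inv S))"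
      using log_det_le_tangent[OF zD(1) pos_def_inv[OF S]] by (simp add: invS)
    also have "\<dots> = b + trace (S ** fst z)"
      using matrix_inv_eqs[OF pos_def_invertible[OF S]] by (simp add: b_def matrix_expand trace_expand)
    finally have ld: "ln (det (fst z)) \<le> b + trace (S ** fst z)" .
    have g0: "0 < snd z * \<rho>\<^sup>2" using zD(4) \<rho> by simp
    have bound: "snd z * \<rho>\<^sup>2 + ?T \<le> c1"
      using fz ld unfolding objective_split(1)[OF z] c1_def by linarith
    then have "snd z * \<rho>\<^sup>2 \<le> c1" "?T \<le> c1" using T g0 by linarith+
    then have \<gamma>: "snd z \<le> \<Gamma>" using \<rho> by (simp add: \<Gamma>_def pos_le_divide_eq)
    have "- ln (det (fst z)) \<le> c" using fz trX T g0 unfolding objective_split(1)[OF z] by linarith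
    then have "exp (- c) \<le> exp (ln (det (fst z)))" by simp
    then have det: "exp (- c) \<le> det (fst z)" using pos_def_det[OF zD(1)] by simp
    have q: "x \<bullet> (fst z *v x) \<le> snd z * (norm x)\<^sup>2" for x
    proof -
      have "0 \<le> x \<bullet> (slack z *v x)" using pos_def_imp_semidef[OF zD(2)] by (simp add: pos_semidef_def)
      then show ?thesis
        by (simp add: slack_def matrix_vector_mult_diff_rdistrib inner_diff_right mat_vec_mult power2_norm_eq_inner)
    qed
    have entry: "\<bar>fst z $ i $ j\<bar> \<le> \<Gamma>" for i j
    proof -
      have e: "axis k 1 \<bullet> (fst z *v axis k 1) \<le> \<Gamma>" "0 \<le> axis k 1 \<bullet> (fst z *v axis k 1)" for k
        using q[of "axis k 1"] \<gamma> pos_def_imp_semidef[OF zD(1)] by (simp_all add: pos_semidef_def)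
      have "(axis i 1 \<bullet> (fst z *v axis j 1))\<^sup>2 \<le> \<Gamma> * \<Gamma>"
        by (rule order_trans[OF pos_semidef_Cauchy_Schwarz[OF pos_def_imp_semidef[OF zD(1)]]])
          (intro mult_mono e \<Gamma>)
      also have "axis i 1 \<bullet> (fst z *v axis j 1) = fst z $ i $ j"
        by (simp add: inner_axis' matrix_vector_mult_basis column_def)
      finally have "\<bar>fst z $ i $ j\<bar>\<^sup>2 \<le> \<Gamma>\<^sup>2" by (simp add: power2_eq_square)
      then show ?thesis using \<Gamma> by (rule power2_le_imp_le)
    qed
    have "(snd z)\<^sup>2 * trace (resolvent z ** S) \<le> c2"
    proof -
      have "snd z * trace S \<le> \<Gamma> * trace S" using \<gamma> trS by (rule mult_right_mono)
      then show ?thesis unfolding objective_split(2)[OF z] c2_def using trX' \<open>?T \<le> c1\<close> by linarith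
    qed
    note tr = this
    have sl: "(snd z)\<^sup>2 * (s * (norm x)\<^sup>2) \<le> c2 * (x \<bullet> (slack z *v x))" for x
    proof -
      have "(snd z)\<^sup>2 * (s * (norm x)\<^sup>2) \<le> (snd z)\<^sup>2 * (trace (resolvent z ** S) * (x \<bullet> (slack z *v x)))"
        unfolding resolvent_def
        by (intro mult_left_mono slack_bound_from_trace[OF zD(2) symS s]) simp
      also have "\<dots> = ((snd z)\<^sup>2 * trace (resolvent z ** S)) * (x \<bullet> (slack z *v x))" by simp
      also have "\<dots> \<le> c2 * (x \<bullet> (slack z *v x))"
        using tr pos_def_imp_semidef[OF zD(2)] by (intro mult_right_mono) (auto simp: pos_semidef_def)
      finally show ?thesis .
    qed
    show "z \<in> B"
      using z zD(4) \<gamma> entry det sl pos_def_imp_semidef[OF zD(1)]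
      by (auto simp: B_def interior_cone_def pos_semidef_def)
  qed
  have "closed (B \<inter> objective S \<rho> -` {..c})"
    by (intro continuous_closed_preimage \<open>closed B\<close> continuous_on_subset[OF continuous_on_objective BF]) simp
  moreover have "?K = B \<inter> objective S \<rho> -` {..c}" using KB BF by auto
  ultimately have "closed ?K" by simp
  moreover have "bounded ?K" using \<open>bounded B\<close> KB by (rule bounded_subset)
  ultimately show ?thesis by (simp add: compact_eq_bounded_closed)
qed

section \<open>Convergence of the algorithm\<close>

theorem proposition4p5:
  fixes S :: "real^'p::finite^'p::finite" and \<rho> \<sigma> :: real
    and E :: "('p \<times> 'p) set"
    and X0 :: "real^'p^'p" and \<gamma>0 :: real
  assumes "S \<succ> 0" and "\<rho> > 0" and "0 < \<sigma>" and "\<sigma> < 1 / 2"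
    and "sym E"
    and "feasible E (X0, \<gamma>0)"
  shows "\<exists>Xs \<gamma>s.
     (\<forall>z. is_arg_min (objective S \<rho>) (feasible E) z \<longleftrightarrow> z = (Xs, \<gamma>s))
     \<and> sqa_iter S \<rho> \<sigma> E (X0, \<gamma>0) \<longlonglongrightarrow> (Xs, \<gamma>s)
     \<and> locally_quadratic_convergence (sqa_iter S \<rho> \<sigma> E (X0, \<gamma>0)) (Xs, \<gamma>s)"
proof -
  have S: "pos_def S" using assms(1) by (simp add: loewner_greater_def)
  have tS: "transpose S = S" using S by (simp add: pos_def_def sym_mat_def)
  note dir = direction_props[OF \<open>sym E\<close> S]
  interpret damped_newton "sym_sparse E" "interior_cone E" "objective S \<rho>" "grad_op S \<rho>" "hess_op S"
    "direction S \<rho> E" "\<lambda>z. step_size S \<rho> \<sigma> z (direction S \<rho> E z)" \<sigma>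
  proof (rule damped_newton.intro)
    show "subspace (sym_sparse E)" by (rule subspace_sym_sparse)
    show "openin (top_of_set (sym_sparse E)) (interior_cone E)" by (rule openin_interior_cone)
    show "convex (interior_cone E)" by (rule convex_interior_cone)
    show "continuous_on (interior_cone E) (objective S \<rho>)" by (rule continuous_on_objective)
    show "((\<lambda>t. objective S \<rho> (x + t *\<^sub>R d)) has_real_derivative grad_op S \<rho> x \<bullet> d) (at 0)"
      if "x \<in> interior_cone E" "d \<in> sym_sparse E" for x d
      by (rule objective_derivative[OF that(1) tS that(2)])
    show "quad_approx C (grad_op S \<rho>) (hess_op S)" if "compact C" "C \<subseteq> interior_cone E" for C
      by (rule quad_approx_grad_op[OF that])
    show "linear (hess_op S x)" for x by (rule linear_hess_op)
    show "\<exists>m>0. \<forall>x\<in>C. \<forall>d\<in>sym_sparse E. m * (norm d)\<^sup>2 \<le> hess_op S x d \<bullet> d"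
      if "compact C" "C \<subseteq> interior_cone E" for C
      by (rule hess_op_coercive[OF S that])
    show "compact {x \<in> interior_cone E. objective S \<rho> x \<le> c}" for c
      by (rule compact_sublevel[OF S \<open>\<rho> > 0\<close>])
    show "direction S \<rho> E x \<in> sym_sparse E" if "x \<in> interior_cone E" for x
      by (rule dir(1)[OF that])
    show "(hess_op S x (direction S \<rho> E x) + grad_op S \<rho> x) \<bullet> v = 0"
      if "x \<in> interior_cone E" "v \<in> sym_sparse E" for x v
      by (rule dir(2)[OF that])
    show "(\<exists>n::nat. step_size S \<rho> \<sigma> x (direction S \<rho> E x) = 1 / 2 ^ n)
        \<and> 1 / 2 ^ m \<le> step_size S \<rho> \<sigma> x (direction S \<rho> E x)
        \<and> x + step_size S \<rho> \<sigma> x (direction S \<rho> E x) *\<^sub>R direction S \<rho> E x \<in> interior_cone E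
        \<and> objective S \<rho> (x + step_size S \<rho> \<sigma> x (direction S \<rho> E x) *\<^sub>R direction S \<rho> E x)
          \<le> objective S \<rho> x + \<sigma> * step_size S \<rho> \<sigma> x (direction S \<rho> E x)
            * (grad_op S \<rho> x \<bullet> direction S \<rho> E x)"
      if "x \<in> interior_cone E" "x + (1 / 2 ^ m) *\<^sub>R direction S \<rho> E x \<in> interior_cone E"
        "objective S \<rho> (x + (1 / 2 ^ m) *\<^sub>R direction S \<rho> E x)
          \<le> objective S \<rho> x + \<sigma> * (1 / 2 ^ m) * (grad_op S \<rho> x \<bullet> direction S \<rho> E x)"
      for x and m :: nat
      by (rule step_size_props[OF that(1) dir(1)[OF that(1)] that(2,3)])
  qed (use assms in auto)
  have z0: "sqa_iter S \<rho> \<sigma> E (X0, \<gamma>0) 0 \<in> interior_cone E"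
    using assms(6) by (simp add: feasible_iff)
  have iter: "sqa_iter S \<rho> \<sigma> E (X0, \<gamma>0) (Suc t) = sqa_iter S \<rho> \<sigma> E (X0, \<gamma>0) t
      + step_size S \<rho> \<sigma> (sqa_iter S \<rho> \<sigma> E (X0, \<gamma>0) t) (direction S \<rho> E (sqa_iter S \<rho> \<sigma> E (X0, \<gamma>0) t))
        *\<^sub>R direction S \<rho> E (sqa_iter S \<rho> \<sigma> E (X0, \<gamma>0) t)" for t
    by (simp add: sqa_step_def Let_def)
  have feas: "feasible E = (\<lambda>z. z \<in> interior_cone E)" by (simp add: fun_eq_iff feasible_iff)
  obtain zs where zs: "\<And>z. is_arg_min (objective S \<rho>) (\<lambda>z. z \<in> interior_cone E) z \<longleftrightarrow> z = zs"
    "sqa_iter S \<rho> \<sigma> E (X0, \<gamma>0) \<longlonglongrightarrow> zs"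
    "locally_quadratic_convergence (sqa_iter S \<rho> \<sigma> E (X0, \<gamma>0)) zs"
    using convergence[OF z0 iter] by blast
  then show ?thesis unfolding feas by (intro exI[of _ "fst zs"] exI[of _ "snd zs"]) simp
qed

end
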